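(* Let $k\ge 1$ and $m\ge 2$ be integers. There is a constant $c>0$, depending only on $k$ and $m$, such that the following holds. Suppose $R$ is a ring and $S\subseteq R$ is a nonempty finite subset satisfying $$|S-S| = K|S|, \quad\text{where } K\le c\,|S|^{1/(2^{k+1}-1)}.$$ Then: (1) There exist distinct subsets $A_1,A_2,\ldots,A_m\subseteq S$ with $|A_i|=\lceil \log_2 m\rceil 2^k$ for every $i$, such that $$\sum_{a\in A_i}a^j=\sum_{b\in A_1}b^j\qquad\text{for } j=1,\ldots,k \text{ and } i=1,\ldots,m.$$ (2) Assume additionally that $R$ is an integral domain with characteristic $\mathrm{char}(R)=0$ or $\mathrm{char}(R)>k+1$. Then there exist $A_1,A_2,\ldots,A_m\subseteq S$ with $|A_i|=\lceil\log_2 m\rceil 2^k$ for every $i$, such that $$\sum_{a\in A_i}a^j=\sum_{b\in A_1}b^j\qquad\text{for } j=1,\ldots,k \text{ and } i=1,\ldots,m,$$ while for all $h,t\in\{1,2,\ldots,m\}$ with $h\ne t$, $$\sum_{a\in A_h}a^{k+1}\ne\sum_{b\in A_t}b^{k+1}.$$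
   Context: Rings are not necessarily commutative. An integral domain is a nonzero commutative ring with a multiplicative identity and no zero divisors. For a subset $S$ of a ring, $S-S=\{a-b: a,b\in S\}$. *)

theory Defs
  imports Complex_Main "HOL-Algebra.Ring"
begin

text \<open>Rings need be neither commutative nor unital.  The record of \<^theory>\<open>HOL-Algebra.Ring\<close> is
  reused, so that \<^locale>\<open>domain\<close> applies to the same structures; its field for the unit is
  unconstrained in \<open>rng\<close>.\<close>

locale rng = abelian_group R for R (structure) +
  assumes m_closed: "\<lbrakk>x \<in> carrier R; y \<in> carrier R\<rbrakk> \<Longrightarrow> x \<otimes> y \<in> carrier R"
    and m_assoc: "\<lbrakk>x \<in> carrier R; y \<in> carrier R; z \<in> carrier R\<rbrakk>
      \<Longrightarrow> (x \<otimes> y) \<otimes> z = x \<otimes> (y \<otimes> z)"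
    and l_distr: "\<lbrakk>x \<in> carrier R; y \<in> carrier R; z \<in> carrier R\<rbrakk>
      \<Longrightarrow> (x \<oplus> y) \<otimes> z = x \<otimes> z \<oplus> y \<otimes> z"
    and r_distr: "\<lbrakk>x \<in> carrier R; y \<in> carrier R; z \<in> carrier R\<rbrakk>
      \<Longrightarrow> z \<otimes> (x \<oplus> y) = z \<otimes> x \<oplus> z \<otimes> y"

lemma (in ring) is_rng: "rng R"
  by unfold_locales (auto simp: m_assoc l_distr r_distr)

text \<open>The power \<open>a\<^sup>j\<close> for \<open>j \<ge> 1\<close>, without reference to a unit (the library's power starts from
  the unit).  The value at \<open>j = 0\<close> is junk and never used.\<close>

definition rng_pow :: "('a, 'b) ring_scheme \<Rightarrow> 'a \<Rightarrow> nat \<Rightarrow> 'a" where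
  "rng_pow R a j = ((\<lambda>x. x \<otimes>\<^bsub>R\<^esub> a) ^^ (j - 1)) a"

lemma (in monoid) funpow_mult_eq_nat_pow:
  "a \<in> carrier G \<Longrightarrow> ((\<lambda>x. x \<otimes> a) ^^ n) a = a [^] Suc n"
  by (induction n) auto

lemma (in ring) rng_pow_eq_nat_pow:
  "\<lbrakk>a \<in> carrier R; j \<ge> 1\<rbrakk> \<Longrightarrow> rng_pow R a j = a [^] j"
  by (cases j) (auto simp: rng_pow_def funpow_mult_eq_nat_pow)

definition power_sum :: "('a, 'b) ring_scheme \<Rightarrow> nat \<Rightarrow> 'a set \<Rightarrow> 'a" where
  "power_sum R j A = (\<Oplus>\<^bsub>R\<^esub>a\<in>A. rng_pow R a j)"

definition difference_set :: "('a, 'b) ring_scheme \<Rightarrow> 'a set \<Rightarrow> 'a set" where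
  "difference_set R S = {a \<ominus>\<^bsub>R\<^esub> b | a b. a \<in> S \<and> b \<in> S}"

definition ring_char :: "('a, 'b) ring_scheme \<Rightarrow> nat" where
  "ring_char R =
    (if \<exists>n::nat. n > 0 \<and> [n] \<cdot>\<^bsub>R\<^esub> \<one>\<^bsub>R\<^esub> = \<zero>\<^bsub>R\<^esub>
     then LEAST n::nat. n > 0 \<and> [n] \<cdot>\<^bsub>R\<^esub> \<one>\<^bsub>R\<^esub> = \<zero>\<^bsub>R\<^esub>
     else 0)"

definition equal_power_sums_family ::
  "('a, 'b) ring_scheme \<Rightarrow> 'a set \<Rightarrow> nat \<Rightarrow> nat \<Rightarrow> (nat \<Rightarrow> 'a set) \<Rightarrow> bool" where
  "equal_power_sums_family R S k m A \<longleftrightarrow>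
    (\<forall>i\<in>{1..m}. A i \<subseteq> S \<and> card (A i) = nat \<lceil>log 2 (real m)\<rceil> * 2 ^ k) \<and>
    (\<forall>j\<in>{1..k}. \<forall>i\<in>{1..m}. power_sum R j (A i) = power_sum R j (A 1))"

definition admissible_constant :: "nat \<Rightarrow> nat \<Rightarrow> real \<Rightarrow> ('a, 'b) ring_scheme \<Rightarrow> bool" where
  "admissible_constant k m c R \<longleftrightarrow>
    (\<forall>S K. S \<subseteq> carrier R \<and> finite S \<and> S \<noteq> {} \<and>
       real (card (difference_set R S)) = K * real (card S) \<and>
       K \<le> c * real (card S) powr (1 / (2 ^ (k + 1) - 1)) \<longrightarrow>
       (\<exists>A. inj_on A {1..m} \<and> equal_power_sums_family R S k m A) \<and>
       (domain R \<and> (ring_char R = 0 \<or> ring_char R > k + 1) \<longrightarrow>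
         (\<exists>A. equal_power_sums_family R S k m A \<and>
           (\<forall>h\<in>{1..m}. \<forall>t\<in>{1..m}. h \<noteq> t \<longrightarrow>
             power_sum R (k + 1) (A h) \<noteq> power_sum R (k + 1) (A t)))))"

text \<open>The constant depends on \<open>k\<close> and \<open>m\<close> only, uniformly over all rings.  A statement
  \<open>\<exists>c>0. \<forall>R :: 'a ring. \<dots>\<close> would let \<open>c\<close> depend on the type \<open>'a\<close>, and HOL cannot quantify
  over types below the existential; hence \<open>c\<close> is named by a constant whose type mentions no
  \<open>'a\<close>.  Choosing it among the constants that work for rings carried by sets of natural
  numbers loses nothing: any constant uniform over all rings is among them, and conversely such a
  constant works for every ring, because a finite \<open>S\<close> lies in a countable subring.
  This definition asserts neither positivity nor the admissibility of the chosen value for any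
  ring; both have to be proved.\<close>

definition uniform_constant :: "nat \<Rightarrow> nat \<Rightarrow> real" where
  "uniform_constant k m =
    (SOME c. c > 0 \<and> (\<forall>R :: nat ring. rng R \<longrightarrow> admissible_constant k m c R))"

end

theory Submission
  imports Defs "HOL-Library.Countable_Set"
begin

text \<open>Call a parity class of vertices of a \<open>(k+1)\<close>-dimensional cube
  \<open>x + {0,d\<^sub>1} + \<dots> + {0,d\<^bsub>k+1\<^esub>}\<close> a half of it. The \<open>j\<close>-th power sums of
  the two halves differ by a \<open>(k+1)\<close>-fold iterated difference of \<open>x\<^sup>j\<close>. This vanishes for
  \<open>j \<le> k\<close> and is \<open>(k+1)! d\<^sub>1 \<cdots> d\<^bsub>k+1\<^esub>\<close> for \<open>j = k+1\<close> in a commutative ring.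
  Hence choosing one half in each of \<open>\<lceil>log\<^sub>2 m\<rceil>\<close> disjoint cubes in \<open>S\<close> gives \<open>m\<close> sets
  with equal power sums up to \<open>k\<close>, and keeping \<open>d\<^bsub>k+1\<^esub>\<close> away from boundedly many values at
  each cube makes the \<open>(k+1)\<close>-th power sums distinct.

  The cubes come from popular differences: as all differences lie in \<open>S - S\<close>, a suitable
  \<open>d\<close> outside any small set satisfies \<open>|T \<inter> (T - d)| \<ge> |T|\<^sup>2 / (2K|S|)\<close> for
  \<open>T \<subseteq> S\<close>. After \<open>k+1\<close> steps about \<open>|S| / (4K)\<^sup>M\<close> elements remain,
  where \<open>M = 2\<^bsup>k+1\<^esup> - 1\<close>; hence the exponent in the hypothesis.\<close>

subsection \<open>Iterated differences\<close>

text \<open>The recursion differences the function and keeps the base point. Inductions over the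
  list therefore need \<open>f\<close> arbitrary, with
  \<open>\<lambda>x. f (x \<oplus> d) \<ominus> f x\<close> as the next function.\<close>

primrec (in abelian_group) iter_diff :: "'a list \<Rightarrow> ('a \<Rightarrow> 'a) \<Rightarrow> 'a \<Rightarrow> 'a" where
  "iter_diff [] f = f"
| "iter_diff (d # ds) f = iter_diff ds (\<lambda>x. f (x \<oplus> d) \<ominus> f x)"

context abelian_group
begin

lemma iter_diff_closed:
  "\<lbrakk>set ds \<subseteq> carrier G; f \<in> carrier G \<rightarrow> carrier G; x \<in> carrier G\<rbrakk>
    \<Longrightarrow> iter_diff ds f x \<in> carrier G"
proof (induction ds arbitrary: f)
  case (Cons d ds)
  then have "(\<lambda>x. f (x \<oplus> d) \<ominus> f x) \<in> carrier G \<rightarrow> carrier G"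
    by auto
  with Cons show ?case by simp
qed auto

lemma iter_diff_cong:
  "\<lbrakk>set ds \<subseteq> carrier G; \<And>y. y \<in> carrier G \<Longrightarrow> f y = g y; x \<in> carrier G\<rbrakk>
    \<Longrightarrow> iter_diff ds f x = iter_diff ds g x"
proof (induction ds arbitrary: f g)
  case (Cons d ds)
  have "iter_diff ds (\<lambda>x. f (x \<oplus> d) \<ominus> f x) x = iter_diff ds (\<lambda>x. g (x \<oplus> d) \<ominus> g x) x"
    using Cons.prems by (intro Cons.IH) auto
  then show ?case by simp
qed auto

lemma iter_diff_add:
  "\<lbrakk>set ds \<subseteq> carrier G; f \<in> carrier G \<rightarrow> carrier G; g \<in> carrier G \<rightarrow> carrier G; x \<in> carrier G\<rbrakk>
    \<Longrightarrow> iter_diff ds (\<lambda>x. f x \<oplus> g x) x = iter_diff ds f x \<oplus> iter_diff ds g x"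
proof (induction ds arbitrary: f g)
  case (Cons d ds)
  have fc: "\<And>y. y \<in> carrier G \<Longrightarrow> f y \<in> carrier G" "\<And>y. y \<in> carrier G \<Longrightarrow> g y \<in> carrier G"
    and d: "d \<in> carrier G"
    using Cons.prems by auto
  have "iter_diff ds (\<lambda>x. f (x \<oplus> d) \<oplus> g (x \<oplus> d) \<ominus> (f x \<oplus> g x)) x
      = iter_diff ds (\<lambda>x. (f (x \<oplus> d) \<ominus> f x) \<oplus> (g (x \<oplus> d) \<ominus> g x)) x"
    using Cons.prems d by (intro iter_diff_cong) (auto simp: fc minus_eq minus_add a_ac)
  also have "\<dots> = iter_diff (d # ds) f x \<oplus> iter_diff (d # ds) g x"
    using Cons.prems d by (subst Cons.IH) (auto simp: fc)
  finally show ?case by simp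
qed auto

text \<open>Commutativity of addition lets the shift by \<open>c\<close> slip past every step. This
  turns the second term of the product rule below into an iterated difference of \<open>f\<close>
  itself.\<close>

lemma iter_diff_shift:
  "\<lbrakk>set ds \<subseteq> carrier G; f \<in> carrier G \<rightarrow> carrier G; x \<in> carrier G; c \<in> carrier G\<rbrakk>
    \<Longrightarrow> iter_diff ds (\<lambda>x. f (x \<oplus> c)) x = iter_diff ds f (x \<oplus> c)"
proof (induction ds arbitrary: f)
  case (Cons d ds)
  have fc: "\<And>y. y \<in> carrier G \<Longrightarrow> f y \<in> carrier G" and d: "d \<in> carrier G"
    using Cons.prems by auto
  have "iter_diff ds (\<lambda>x. f (x \<oplus> d \<oplus> c) \<ominus> f (x \<oplus> c)) x
      = iter_diff ds (\<lambda>x. (\<lambda>y. f (y \<oplus> d) \<ominus> f y) (x \<oplus> c)) x"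
    using Cons.prems d by (intro iter_diff_cong) (auto simp: a_ac)
  also have "\<dots> = iter_diff (d # ds) f (x \<oplus> c)"
    using Cons.prems d by (subst Cons.IH) (auto simp: fc)
  finally show ?case by simp
qed auto

lemma iter_diff_zero:
  "\<lbrakk>set ds \<subseteq> carrier G; x \<in> carrier G\<rbrakk> \<Longrightarrow> iter_diff ds (\<lambda>x. \<zero>) x = \<zero>"
proof (induction ds)
  case (Cons d ds)
  have "\<zero> \<ominus> \<zero> = \<zero>" by (metis minus_eq r_neg zero_closed)
  with Cons show ?case by simp
qed auto

end

section \<open>Differences of powers without commutativity or a unit\<close>

context rng
begin

lemma l_null: "x \<in> carrier R \<Longrightarrow> \<zero> \<otimes> x = \<zero>"
  by (metis l_distr add.l_cancel_one' m_closed zero_closed l_zero)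

lemma l_minus:
  assumes "x \<in> carrier R" "y \<in> carrier R"
  shows "(\<ominus> x) \<otimes> y = \<ominus> (x \<otimes> y)"
proof -
  have "(\<ominus> x) \<otimes> y \<oplus> x \<otimes> y = \<zero>"
    using assms by (simp add: l_distr[symmetric] l_neg l_null)
  then show ?thesis
    using assms by (metis minus_equality m_closed a_inv_closed)
qed

lemma iter_diff_mult_right:
  "\<lbrakk>set ds \<subseteq> carrier R; f \<in> carrier R \<rightarrow> carrier R; x \<in> carrier R; c \<in> carrier R\<rbrakk>
    \<Longrightarrow> iter_diff ds (\<lambda>x. f x \<otimes> c) x = iter_diff ds f x \<otimes> c"
proof (induction ds arbitrary: f)
  case (Cons d ds)
  have fc: "\<And>y. y \<in> carrier R \<Longrightarrow> f y \<in> carrier R" and d: "d \<in> carrier R"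
    using Cons.prems by auto
  have "iter_diff ds (\<lambda>x. f (x \<oplus> d) \<otimes> c \<ominus> f x \<otimes> c) x
      = iter_diff ds (\<lambda>x. (f (x \<oplus> d) \<ominus> f x) \<otimes> c) x"
    using Cons.prems d by (intro iter_diff_cong) (auto simp: fc minus_eq l_distr l_minus)
  also have "\<dots> = iter_diff (d # ds) f x \<otimes> c"
    using Cons.prems d by (subst Cons.IH) (auto simp: fc)
  finally show ?case by simp
qed auto

text \<open>A discrete product rule: expanding
  \<open>f (x \<oplus> d) \<otimes> (x \<oplus> d)\<close> leaves the difference of \<open>f\<close>
  times \<open>x\<close> plus \<open>f (x \<oplus> d) \<otimes> d\<close>. The constant right factor
  \<open>d\<close> can then be pulled out. No commutativity enters, since new factors only appear on
  the right.\<close>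

lemma iter_diff_times_id:
  assumes "set ds \<subseteq> carrier R" "f \<in> carrier R \<rightarrow> carrier R" "x \<in> carrier R" "d \<in> carrier R"
  shows "iter_diff (d # ds) (\<lambda>x. f x \<otimes> x) x =
    iter_diff ds (\<lambda>x. (f (x \<oplus> d) \<ominus> f x) \<otimes> x) x \<oplus> iter_diff ds f (x \<oplus> d) \<otimes> d"
proof -
  have fc: "\<And>y. y \<in> carrier R \<Longrightarrow> f y \<in> carrier R"
    using assms by auto
  have "iter_diff (d # ds) (\<lambda>x. f x \<otimes> x) x =
      iter_diff ds (\<lambda>x. (f (x \<oplus> d) \<ominus> f x) \<otimes> x \<oplus> f (x \<oplus> d) \<otimes> d) x"
    using assms unfolding iter_diff.simps
    by (intro iter_diff_cong) (auto simp: fc m_closed minus_eq l_distr r_distr l_minus a_ac)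
  also have "\<dots> = iter_diff ds (\<lambda>x. (f (x \<oplus> d) \<ominus> f x) \<otimes> x) x
      \<oplus> iter_diff ds (\<lambda>x. f (x \<oplus> d) \<otimes> d) x"
    using assms by (intro iter_diff_add) (auto simp: fc m_closed)
  also have "iter_diff ds (\<lambda>x. f (x \<oplus> d) \<otimes> d) x = iter_diff ds (\<lambda>x. f (x \<oplus> d)) x \<otimes> d"
    using assms by (intro iter_diff_mult_right) (auto simp: fc m_closed)
  also have "iter_diff ds (\<lambda>x. f (x \<oplus> d)) x = iter_diff ds f (x \<oplus> d)"
    using assms by (intro iter_diff_shift) auto
  finally show ?thesis .
qed

text \<open>A factor \<open>x\<close> raises the degree by at most one, where degree below
  \<open>n\<close> means that all differences of order at least \<open>n\<close> vanish. In the
  product rule the difference of \<open>f\<close> has degree one less, so induction handles the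
  first term; the second vanishes by assumption.\<close>

lemma iter_diff_times_id_eq_zero:
  assumes "\<And>ds x. \<lbrakk>set ds \<subseteq> carrier R; n \<le> length ds; x \<in> carrier R\<rbrakk> \<Longrightarrow> iter_diff ds f x = \<zero>"
    and "f \<in> carrier R \<rightarrow> carrier R" "set ds \<subseteq> carrier R" "Suc n \<le> length ds" "x \<in> carrier R"
  shows "iter_diff ds (\<lambda>x. f x \<otimes> x) x = \<zero>"
  using assms
proof (induction n arbitrary: f ds)
  case 0
  \<comment> \<open>For \<open>n = 0\<close> the assumption covers the empty list of steps, so
    \<open>f\<close> itself vanishes.\<close>
  have "f y = \<zero>" if "y \<in> carrier R" for y
    using "0.prems"(1)[of "[]" y] that by simp
  then have "iter_diff ds (\<lambda>x. f x \<otimes> x) x = iter_diff ds (\<lambda>x. \<zero>) x"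
    using "0.prems" by (intro iter_diff_cong) (auto simp: l_null)
  then show ?case using "0.prems" by (simp add: iter_diff_zero)
next
  case (Suc n)
  obtain d es where ds: "ds = d # es" using Suc.prems by (cases ds) auto
  have d: "d \<in> carrier R" and es: "set es \<subseteq> carrier R" "Suc n \<le> length es"
    using Suc.prems ds by auto
  have "iter_diff es (\<lambda>x. (f (x \<oplus> d) \<ominus> f x) \<otimes> x) x = \<zero>"
  proof (rule Suc.IH)
    fix bs y assume "set bs \<subseteq> carrier R" "n \<le> length bs" "y \<in> carrier R"
    then show "iter_diff bs (\<lambda>x. f (x \<oplus> d) \<ominus> f x) y = \<zero>"
      using Suc.prems(1)[of "d # bs" y] d by simp
  next
    show "(\<lambda>x. f (x \<oplus> d) \<ominus> f x) \<in> carrier R \<rightarrow> carrier R"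
      using Suc.prems(2) d by (auto simp: Pi_iff)
  qed (use Suc.prems es in auto)
  moreover have "iter_diff es f (x \<oplus> d) = \<zero>"
    using Suc.prems(1)[of es "x \<oplus> d"] Suc.prems es d by simp
  ultimately show ?case
    using Suc.prems es d iter_diff_times_id[of es f x d] by (simp add: ds l_null del: iter_diff.simps)
qed

lemma rng_pow_1 [simp]: "rng_pow R x (Suc 0) = x"
  by (simp add: rng_pow_def)

lemma rng_pow_Suc: "j \<ge> 1 \<Longrightarrow> rng_pow R x (Suc j) = rng_pow R x j \<otimes> x"
  by (cases j) (auto simp: rng_pow_def)

lemma rng_pow_closed: "x \<in> carrier R \<Longrightarrow> rng_pow R x j \<in> carrier R"
proof -
  assume x: "x \<in> carrier R"
  have "((\<lambda>y. y \<otimes> x) ^^ n) x \<in> carrier R" for n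
    by (induction n) (auto simp: x m_closed)
  then show ?thesis by (simp add: rng_pow_def)
qed

text \<open>Each further factor \<open>x\<close> costs one more difference. The induction starts at
  \<open>j = 1\<close>, where two differences annihilate the identity, because
  \<open>rng_pow\<close> has no meaningful value at \<open>j = 0\<close>.\<close>

lemma iter_diff_rng_pow_eq_zero:
  assumes "j \<ge> 1" "set ds \<subseteq> carrier R" "j < length ds" "x \<in> carrier R"
  shows "iter_diff ds (\<lambda>x. rng_pow R x j) x = \<zero>"
  using assms
proof (induction j arbitrary: ds x rule: nat_induct_at_least)
  case base
  then obtain a b es where ds: "ds = a # b # es"
    by (metis length_0_conv length_Suc_conv less_Suc_eq list.exhaust One_nat_def less_nat_zero_code)
  have "y \<oplus> b \<oplus> a \<ominus> (y \<oplus> b) \<ominus> (y \<oplus> a \<ominus> y) = \<zero>" if "y \<in> carrier R" for y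
  proof -
    have "y \<oplus> b \<oplus> a \<ominus> (y \<oplus> b) = a" "y \<oplus> a \<ominus> y = a"
      using base ds that by (auto simp: minus_eq minus_add a_ac r_neg r_neg1 r_neg2)
    then show ?thesis using base ds by (simp add: minus_eq r_neg)
  qed
  then have "iter_diff es (\<lambda>y. y \<oplus> b \<oplus> a \<ominus> (y \<oplus> b) \<ominus> (y \<oplus> a \<ominus> y)) x
      = iter_diff es (\<lambda>y. \<zero>) x"
    using base ds by (intro iter_diff_cong) auto
  then show ?case using base by (simp add: ds iter_diff_zero)
next
  case (Suc j)
  show ?case
    unfolding rng_pow_Suc[OF Suc.hyps]
    using Suc.prems Suc.IH
    by (intro iter_diff_times_id_eq_zero[where n = "Suc j"]) (auto simp: rng_pow_closed)
qed

end

text \<open>The difference of \<open>f\<close> by \<open>d\<close> has leading constant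
  \<open>C \<otimes> d\<close>. By induction the first term of the product rule contributes
  \<open>n\<close> copies of the product of all steps, for \<open>n + 1\<close> steps in total, and
  the second term contributes one more. Commutativity moves \<open>d\<close> to its place in the
  product.\<close>

lemma (in cring) iter_diff_times_id_leading:
  assumes "\<And>ds x. \<lbrakk>set ds \<subseteq> carrier R; length ds = n; x \<in> carrier R\<rbrakk>
      \<Longrightarrow> iter_diff ds f x = C \<otimes> foldr (\<otimes>) ds \<one>"
    and "f \<in> carrier R \<rightarrow> carrier R" "C \<in> carrier R"
    and "set ds \<subseteq> carrier R" "length ds = Suc n" "x \<in> carrier R"
  shows "iter_diff ds (\<lambda>x. f x \<otimes> x) x = [Suc n] \<cdot> (C \<otimes> foldr (\<otimes>) ds \<one>)"
  using assms
proof (induction n arbitrary: f ds C)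
  case 0
  interpret R: rng R by (rule is_rng)
  obtain d where ds: "ds = [d]" "d \<in> carrier R"
    using "0.prems"(4,5) by (auto simp: length_Suc_conv)
  have "f y = C" if "y \<in> carrier R" for y
    using "0.prems"(1)[of "[]" y] "0.prems"(3) that by simp
  then show ?case
    using "0.prems" ds R.iter_diff_times_id[of "[]" f x d]
    by (simp add: minus_eq r_neg add.nat_pow_Suc)
next
  case (Suc n)
  interpret R: rng R by (rule is_rng)
  obtain d es where ds: "ds = d # es" using Suc.prems by (cases ds) auto
  have d: "d \<in> carrier R" and es: "set es \<subseteq> carrier R" "length es = Suc n"
    using Suc.prems ds by auto
  have p: "foldr (\<otimes>) es \<one> \<in> carrier R" if "set es \<subseteq> carrier R" for es
    using that by (induction es) auto
  have "iter_diff es (\<lambda>x. (f (x \<oplus> d) \<ominus> f x) \<otimes> x) x = [Suc n] \<cdot> ((C \<otimes> d) \<otimes> foldr (\<otimes>) es \<one>)"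
  proof (rule Suc.IH)
    fix bs y assume "set bs \<subseteq> carrier R" "length bs = n" "y \<in> carrier R"
    then show "iter_diff bs (\<lambda>x. f (x \<oplus> d) \<ominus> f x) y = C \<otimes> d \<otimes> foldr (\<otimes>) bs \<one>"
      using Suc.prems(1)[of "d # bs" y] Suc.prems(3) d p[of bs] by (simp add: m_assoc)
  next
    show "(\<lambda>x. f (x \<oplus> d) \<ominus> f x) \<in> carrier R \<rightarrow> carrier R"
      using Suc.prems(2) d by (auto simp: Pi_iff)
  qed (use Suc.prems es d in auto)
  moreover have "iter_diff es f (x \<oplus> d) = C \<otimes> foldr (\<otimes>) es \<one>"
    using Suc.prems(1)[of es "x \<oplus> d"] Suc.prems es d by simp
  moreover have "iter_diff ds (\<lambda>x. f x \<otimes> x) x =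
    iter_diff es (\<lambda>x. (f (x \<oplus> d) \<ominus> f x) \<otimes> x) x \<oplus> iter_diff es f (x \<oplus> d) \<otimes> d"
    using Suc.prems es d R.iter_diff_times_id[of es f x d] by (simp add: ds del: iter_diff.simps)
  ultimately have "iter_diff ds (\<lambda>x. f x \<otimes> x) x =
    [Suc n] \<cdot> ((C \<otimes> d) \<otimes> foldr (\<otimes>) es \<one>) \<oplus> C \<otimes> foldr (\<otimes>) es \<one> \<otimes> d" by simp
  also have "(C \<otimes> d) \<otimes> foldr (\<otimes>) es \<one> = C \<otimes> foldr (\<otimes>) ds \<one>"
    using Suc.prems d p[OF es(1)] by (simp add: ds m_assoc)
  also have "C \<otimes> foldr (\<otimes>) es \<one> \<otimes> d = C \<otimes> foldr (\<otimes>) ds \<one>"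
    using Suc.prems d p[OF es(1)] by (simp add: ds m_ac)
  finally show ?case by (simp add: add.nat_pow_Suc)
qed

text \<open>Passing from exponent \<open>n\<close> to \<open>Suc n\<close> multiplies the
  coefficient by \<open>Suc n\<close>, which builds up the factorial.\<close>

lemma (in cring) iter_diff_rng_pow_leading:
  assumes "n \<ge> 1"
  shows "\<lbrakk>set ds \<subseteq> carrier R; length ds = n; x \<in> carrier R\<rbrakk>
    \<Longrightarrow> iter_diff ds (\<lambda>x. rng_pow R x n) x = ([(fact n::nat)] \<cdot> \<one>) \<otimes> foldr (\<otimes>) ds \<one>"
  using assms
proof (induction n arbitrary: ds x rule: nat_induct_at_least)
  case base
  then obtain d where ds: "ds = [d]" "d \<in> carrier R"
    by (auto simp: length_Suc_conv)
  then show ?case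
    using base by (simp add: minus_eq rng_pow_def a_ac r_neg r_neg1 r_neg2)
next
  case (Suc n)
  interpret R: rng R by (rule is_rng)
  have p: "foldr (\<otimes>) ds \<one> \<in> carrier R"
    using Suc.prems(1) by (induction ds) auto
  have "iter_diff ds (\<lambda>x. rng_pow R x n \<otimes> x) x
    = [Suc n] \<cdot> (([(fact n::nat)] \<cdot> \<one>) \<otimes> foldr (\<otimes>) ds \<one>)"
    using Suc.prems by (intro iter_diff_times_id_leading Suc.IH) (auto simp: R.rng_pow_closed)
  also have "\<dots> = ([(fact (Suc n)::nat)] \<cdot> \<one>) \<otimes> foldr (\<otimes>) ds \<one>"
    using p by (simp add: add_pow_ldistr[symmetric] add.nat_pow_pow mult.commute
        del: add.nat_pow_Suc)
  finally show ?case
    using Suc.hyps by (simp add: R.rng_pow_Suc)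
qed

subsection \<open>Parity classes of cubes\<close>

context abelian_group
begin

lemma a_inv_zero: "\<ominus> \<zero> = \<zero>"
  by (metis a_inv_closed l_zero r_neg zero_closed)

lemma minus_eq_minus_if_add_eq_add:
  assumes "a \<in> carrier G" "b \<in> carrier G" "x \<in> carrier G" "y \<in> carrier G" "a \<oplus> x = b \<oplus> y"
  shows "x \<ominus> y = b \<ominus> a"
proof -
  have "x = \<ominus> a \<oplus> (b \<oplus> y)"
    using assms r_neg1[of a x] by simp
  then have "x \<ominus> y = \<ominus> a \<oplus> (b \<oplus> y) \<oplus> \<ominus> y"
    by (simp only: minus_eq)
  also have "\<dots> = \<ominus> a \<oplus> b"
    using assms(1-4) by (simp add: a_assoc r_neg)
  also have "\<dots> = b \<ominus> a"
    using assms(1,2) by (simp add: minus_eq a_comm)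
  finally show ?thesis .
qed

lemma eq_if_minus_eq_zero:
  assumes "a \<in> carrier G" "b \<in> carrier G" "a \<ominus> b = \<zero>"
  shows "a = b"
proof -
  have "a = (a \<ominus> b) \<oplus> b"
    using assms(1,2) by (simp add: minus_eq a_assoc l_neg)
  then show ?thesis using assms(2) by (simp only: assms(3) l_zero)
qed

lemma iter_diff_diff:
  assumes "set ds \<subseteq> carrier G" "f \<in> carrier G \<rightarrow> carrier G" "g \<in> carrier G \<rightarrow> carrier G"
    "x \<in> carrier G"
  shows "iter_diff ds (\<lambda>x. f x \<ominus> g x) x = iter_diff ds f x \<ominus> iter_diff ds g x"
proof -
  have h: "(\<lambda>x. f x \<ominus> g x) \<in> carrier G \<rightarrow> carrier G"
    using assms by (auto simp: Pi_iff)
  have "iter_diff ds f x = iter_diff ds (\<lambda>x. (f x \<ominus> g x) \<oplus> g x) x"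
    using assms by (intro iter_diff_cong) (auto simp: Pi_iff minus_eq a_assoc l_neg)
  also have "\<dots> = iter_diff ds (\<lambda>x. f x \<ominus> g x) x \<oplus> iter_diff ds g x"
    using assms h by (intro iter_diff_add)
  finally show ?thesis
    using iter_diff_closed[OF assms(1) h assms(4)] iter_diff_closed[OF assms(1,3,4)]
    by (simp add: minus_eq a_assoc r_neg)
qed

text \<open>Parity counts the steps that are left out, so that \<open>cube_half ds True\<close> enters the iterated
  difference with positive sign in every dimension.\<close>

primrec cube_half :: "'a list \<Rightarrow> bool \<Rightarrow> 'a set" where
  "cube_half [] b = (if b then {\<zero>} else {})"
| "cube_half (d # ds) b = (\<lambda>v. v \<oplus> d) ` cube_half ds b \<union> cube_half ds (\<not> b)"

definition cube :: "'a list \<Rightarrow> 'a set" where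
  "cube ds = cube_half ds True \<union> cube_half ds False"

text \<open>The condition on \<open>d\<close> makes the cube on \<open>ds\<close> disjoint from its
  translate by \<open>d\<close>. Hence no two vertices coincide and the parity of a vertex is well
  defined.\<close>

primrec proper_cube :: "'a list \<Rightarrow> bool" where
  "proper_cube [] \<longleftrightarrow> True"
| "proper_cube (d # ds) \<longleftrightarrow> d \<in> carrier G \<and> d \<notin> difference_set G (cube ds) \<and> proper_cube ds"

lemma cube_half_subset_cube: "cube_half ds b \<subseteq> cube ds"
  by (cases b) (auto simp: cube_def)

lemma cube_Cons: "cube (d # ds) = (\<lambda>v. v \<oplus> d) ` cube ds \<union> cube ds"
  by (auto simp: cube_def)

lemma cube_Nil: "cube [] = {\<zero>}"
  by (simp add: cube_def)

lemma zero_in_cube: "\<zero> \<in> cube ds"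
  by (induction ds) (auto simp: cube_Nil cube_Cons)

lemma finite_cube: "finite (cube ds)"
  by (induction ds) (auto simp: cube_Nil cube_Cons)

lemma finite_cube_half: "finite (cube_half ds b)"
  by (rule finite_subset[OF cube_half_subset_cube finite_cube])

lemma proper_cube_imp_carrier: "proper_cube ds \<Longrightarrow> set ds \<subseteq> carrier G"
  by (induction ds) auto

lemma cube_carrier: "set ds \<subseteq> carrier G \<Longrightarrow> cube ds \<subseteq> carrier G"
  by (induction ds) (auto simp: cube_Nil cube_Cons subset_iff)

lemma cube_half_carrier: "set ds \<subseteq> carrier G \<Longrightarrow> cube_half ds b \<subseteq> carrier G"
  using cube_half_subset_cube cube_carrier by (rule subset_trans)

lemma card_cube_le: "card (cube ds) \<le> 2 ^ length ds"
proof (induction ds)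
  case (Cons d ds)
  have "card (cube (d # ds)) \<le> card ((\<lambda>v. v \<oplus> d) ` cube ds) + card (cube ds)"
    unfolding cube_Cons by (rule card_Un_le)
  also have "\<dots> \<le> 2 * card (cube ds)"
    using card_image_le[OF finite_cube] by (simp add: mult_2)
  finally show ?case using Cons by simp
qed (simp add: cube_Nil)

text \<open>A vertex \<open>v \<oplus> d\<close> lying in the untranslated cube would exhibit
  \<open>d\<close> as the difference of two of its vertices.\<close>

lemma cube_translate_disjoint:
  assumes "proper_cube (d # ds)"
  shows "(\<lambda>v. v \<oplus> d) ` cube ds \<inter> cube ds = {}"
proof -
  have "d = (v \<oplus> d) \<ominus> v" if "v \<in> carrier G" for v
    using assms that by (simp add: minus_eq a_ac r_neg r_neg1 r_neg2)
  moreover have "cube ds \<subseteq> carrier G"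
    using assms by (simp add: cube_carrier proper_cube_imp_carrier)
  ultimately show ?thesis
    using assms unfolding proper_cube.simps difference_set_def by blast
qed

lemma inj_on_translate: "\<lbrakk>A \<subseteq> carrier G; d \<in> carrier G\<rbrakk> \<Longrightarrow> inj_on (\<lambda>v. v \<oplus> d) A"
  using add.inj_on_multc[of d] by (rule inj_on_subset)

text \<open>A translated piece cannot meet an untranslated one. Two pieces on the same side are
  disjoint by the claim for \<open>ds\<close>, which injectivity of translation carries over to the
  translated side.\<close>

lemma cube_half_disjoint: "proper_cube ds \<Longrightarrow> cube_half ds b \<inter> cube_half ds (\<not> b) = {}"
proof (induction ds arbitrary: b)
  case (Cons d ds)
  have "inj_on (\<lambda>v. v \<oplus> d) (cube ds)"
    using Cons.prems cube_carrier[of ds] proper_cube_imp_carrier[of ds]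
    by (intro inj_on_translate) auto
  moreover have "cube_half ds True \<inter> cube_half ds False = {}"
    using Cons.IH[of True] Cons.prems by auto
  ultimately have "(\<lambda>v. v \<oplus> d) ` cube_half ds True \<inter> (\<lambda>v. v \<oplus> d) ` cube_half ds False = {}"
    using inj_on_image_Int[OF _ cube_half_subset_cube cube_half_subset_cube] by (metis image_empty)
  with cube_translate_disjoint[OF Cons.prems] \<open>cube_half ds True \<inter> cube_half ds False = {}\<close>
  show ?case
    unfolding cube_def by (cases b) auto
qed auto

lemma card_cube_half_Cons:
  assumes "proper_cube (d # ds)"
  shows "card (cube_half (d # ds) b) = card (cube_half ds b) + card (cube_half ds (\<not> b))"
proof -
  have "inj_on (\<lambda>v. v \<oplus> d) (cube_half ds b)"
    using assms cube_half_carrier[of ds b] proper_cube_imp_carrier[of ds]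
    by (intro inj_on_translate) auto
  moreover have "(\<lambda>v. v \<oplus> d) ` cube_half ds b \<inter> cube_half ds (\<not> b) = {}"
    using cube_translate_disjoint[OF assms] cube_half_subset_cube by fast
  ultimately show ?thesis
    by (simp add: card_Un_disjoint finite_cube_half card_image)
qed

text \<open>The dimension is \<open>Suc n\<close> because the halves are balanced only from
  dimension one on: in dimension zero they have one element and none.\<close>

lemma card_cube_half:
  "proper_cube ds \<Longrightarrow> length ds = Suc n \<Longrightarrow> card (cube_half ds b) = 2 ^ n"
proof (induction n arbitrary: ds b)
  case 0
  from \<open>length ds = Suc 0\<close> obtain d where "ds = [d]" by (auto simp: length_Suc_conv)
  then show ?case by (cases b) simp_all
next
  case (Suc n)
  then obtain d es where ds: "ds = d # es" by (cases ds) auto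
  then show ?case
    using Suc.IH[of es b] Suc.IH[of es "\<not> b"] Suc.prems card_cube_half_Cons[of d es b]
    by (simp del: cube_half.simps)
qed

section \<open>Signed sums over a cube as iterated differences\<close>

lemma finsum_cube_half_Cons:
  assumes "proper_cube (d # ds)" "f \<in> carrier G \<rightarrow> carrier G" "x \<in> carrier G"
  shows "(\<Oplus>v\<in>cube_half (d # ds) b. f (v \<oplus> x)) =
    (\<Oplus>v\<in>cube_half ds b. f (v \<oplus> x \<oplus> d)) \<oplus> (\<Oplus>v\<in>cube_half ds (\<not> b). f (v \<oplus> x))"
proof -
  have c: "cube_half ds c \<subseteq> carrier G" for c
    using assms cube_half_carrier[of ds c] proper_cube_imp_carrier[of ds] by simp
  have cv: "\<And>v c. v \<in> cube_half ds c \<Longrightarrow> v \<in> carrier G"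
    and fc: "\<And>y. y \<in> carrier G \<Longrightarrow> f y \<in> carrier G"
    using c assms(2) by auto
  have d: "d \<in> carrier G" using assms by simp
  have inj: "inj_on (\<lambda>v. v \<oplus> d) (cube_half ds b)"
    using c d by (intro inj_on_translate) auto
  have "(\<lambda>v. v \<oplus> d) ` cube_half ds b \<inter> cube_half ds (\<not> b) = {}"
    using cube_translate_disjoint[OF assms(1)] cube_half_subset_cube by fast
  then have "(\<Oplus>v\<in>cube_half (d # ds) b. f (v \<oplus> x)) =
    (\<Oplus>v\<in>(\<lambda>v. v \<oplus> d) ` cube_half ds b. f (v \<oplus> x)) \<oplus> (\<Oplus>v\<in>cube_half ds (\<not> b). f (v \<oplus> x))"
    unfolding cube_half.simps using d assms(3)
    by (intro finsum_Un_disjoint) (auto simp: finite_cube_half cv fc)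
  also have "(\<Oplus>v\<in>(\<lambda>v. v \<oplus> d) ` cube_half ds b. f (v \<oplus> x))
    = (\<Oplus>v\<in>cube_half ds b. f (v \<oplus> d \<oplus> x))"
    using d assms(3) inj by (intro finsum_reindex) (auto simp: cv fc)
  also have "\<dots> = (\<Oplus>v\<in>cube_half ds b. f (v \<oplus> x \<oplus> d))"
    using d assms(3) by (intro finsum_cong') (auto simp: cv fc a_ac)
  finally show ?thesis .
qed

text \<open>Taking the step \<open>d\<close> keeps the sign of a vertex and leaving it out flips the
  sign. The four partial sums over \<open>ds\<close> thus regroup into the signed sum of
  \<open>f (y \<oplus> d)\<close> minus that of \<open>f\<close>.\<close>

lemma finsum_cube_half_diff:
  "\<lbrakk>proper_cube ds; f \<in> carrier G \<rightarrow> carrier G; x \<in> carrier G\<rbrakk> \<Longrightarrow>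
    (\<Oplus>v\<in>cube_half ds True. f (v \<oplus> x)) \<ominus> (\<Oplus>v\<in>cube_half ds False. f (v \<oplus> x)) = iter_diff ds f x"
proof (induction ds arbitrary: f)
  case Nil
  then show ?case by (simp add: Pi_iff minus_eq a_inv_zero)
next
  case (Cons d ds)
  let ?S = "\<lambda>f b. \<Oplus>v\<in>cube_half ds b. f (v \<oplus> x)"
  let ?g = "\<lambda>y. f (y \<oplus> d)"
  have d: "d \<in> carrier G" and ds: "proper_cube ds" "set ds \<subseteq> carrier G"
    using Cons.prems proper_cube_imp_carrier by auto
  have g: "?g \<in> carrier G \<rightarrow> carrier G"
    using Cons.prems d by auto
  have cl: "?S h b \<in> carrier G" if "h \<in> carrier G \<rightarrow> carrier G" for h b
    using that cube_half_carrier[OF ds(2)] Cons.prems by (intro finsum_closed) (auto simp: Pi_iff subset_iff)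
  have "iter_diff (d # ds) f x = iter_diff ds ?g x \<ominus> iter_diff ds f x"
    using Cons.prems ds g by (simp add: iter_diff_diff)
  also have "iter_diff ds ?g x = ?S ?g True \<ominus> ?S ?g False"
    using Cons.IH[OF ds(1) g] Cons.prems by simp
  also have "iter_diff ds f x = ?S f True \<ominus> ?S f False"
    using Cons.IH[OF ds(1)] Cons.prems by simp
  also have "?S ?g True \<ominus> ?S ?g False \<ominus> (?S f True \<ominus> ?S f False)
    = (?S ?g True \<oplus> ?S f False) \<ominus> (?S ?g False \<oplus> ?S f True)"
    using cl[OF g] cl[OF Cons.prems(2)] by (simp add: minus_eq minus_add a_ac)
  finally show ?case
    using finsum_cube_half_Cons[OF Cons.prems, of True] finsum_cube_half_Cons[OF Cons.prems, of False]
    by simp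
qed

end

lemma (in rng) power_sum_cube_diff:
  assumes "proper_cube ds" "x \<in> carrier R"
  shows "power_sum R j ((\<lambda>v. v \<oplus> x) ` cube_half ds True) \<ominus>
    power_sum R j ((\<lambda>v. v \<oplus> x) ` cube_half ds False) = iter_diff ds (\<lambda>x. rng_pow R x j) x"
proof -
  have c: "cube_half ds b \<subseteq> carrier R" for b
    using assms cube_half_carrier[of ds b] proper_cube_imp_carrier[of ds] by simp
  have "power_sum R j ((\<lambda>v. v \<oplus> x) ` cube_half ds b) = (\<Oplus>v\<in>cube_half ds b. rng_pow R (v \<oplus> x) j)" for b
    unfolding power_sum_def using c[of b] assms(2)
    by (intro finsum_reindex inj_on_translate) (auto simp: rng_pow_closed subset_iff)
  then show ?thesis
    using finsum_cube_half_diff[OF assms(1) _ assms(2), of "\<lambda>x. rng_pow R x j"]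
    by (simp add: Pi_iff rng_pow_closed)
qed

subsection \<open>Popular differences\<close>

lemma difference_set_eq_image: "difference_set G S = (\<lambda>(a, b). a \<ominus>\<^bsub>G\<^esub> b) ` (S \<times> S)"
  by (auto simp: difference_set_def)

lemma finite_difference_set: "finite S \<Longrightarrow> finite (difference_set G S)"
  by (simp add: difference_set_eq_image)

lemma card_difference_set_le: "finite S \<Longrightarrow> card (difference_set G S) \<le> card S ^ 2"
  unfolding difference_set_eq_image power2_eq_square
  by (metis card_image_le card_cartesian_product finite_SigmaI)

context abelian_group
begin

lemma difference_set_carrier: "S \<subseteq> carrier G \<Longrightarrow> difference_set G S \<subseteq> carrier G"
  by (auto simp: difference_set_def)

lemma inj_on_minus_right: "b \<in> carrier G \<Longrightarrow> inj_on (\<lambda>a. a \<ominus> b) (carrier G)"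
  using add.inj_on_multc[of "\<ominus> b"] by (simp add: minus_eq)

lemma card_le_card_difference_set:
  assumes "finite S" "S \<subseteq> carrier G"
  shows "card S \<le> card (difference_set G S)"
proof (cases "S = {}")
  case False
  then obtain s where "s \<in> S" by auto
  then have "(\<lambda>a. a \<ominus> s) ` S \<subseteq> difference_set G S" "inj_on (\<lambda>a. a \<ominus> s) S"
    using assms inj_on_minus_right[of s]
    by (auto simp: difference_set_def intro: inj_on_subset)
  then show ?thesis
    using assms finite_difference_set by (metis card_inj_on_le)
qed simp

text \<open>Double counting of the pairs \<open>(b, d)\<close> with \<open>b\<close> and
  \<open>b \<oplus> d\<close> in \<open>T\<close> and \<open>d\<close> outside \<open>E\<close>.
  Each \<open>b\<close> lies in at least \<open>card T - card E\<close> such pairs, and at most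
  \<open>card D\<close> values of \<open>d\<close> share them, so some \<open>d\<close> is at least
  average.\<close>

lemma popular_difference:
  assumes "finite T" "T \<subseteq> carrier G" "finite D" "difference_set G T \<subseteq> D" "finite E" "card E < card T"
  obtains d where "d \<in> D - E"
    "card T * (card T - card E) \<le> card D * card {b \<in> T. b \<oplus> d \<in> T}"
proof (rule ccontr)
  assume "\<not> thesis"
  with that have less: "card D * card {b \<in> T. b \<oplus> d \<in> T} < card T * (card T - card E)"
    if "d \<in> D - E" for d using \<open>d \<in> D - E\<close> by (meson not_le)
  have fiber: "card T - card E \<le> card {d \<in> D - E. b \<oplus> d \<in> T}" if b: "b \<in> T" for b
  proof -
    \<comment> \<open>The differences from \<open>b\<close> to the points of \<open>T\<close> are
      distinct and lie in \<open>D\<close>; at most \<open>card E\<close> of them are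
      forbidden.\<close>
    have "(\<lambda>a. a \<ominus> b) ` T - E \<subseteq> {d \<in> D - E. b \<oplus> d \<in> T}"
      using assms(2,4) b by (auto simp: difference_set_def minus_eq a_ac r_neg1 r_neg2 r_neg subset_iff)
    moreover have "card ((\<lambda>a. a \<ominus> b) ` T) = card T"
      using inj_on_minus_right[of b] assms(2) b by (intro card_image) (auto intro: inj_on_subset)
    moreover have "finite {d \<in> D - E. b \<oplus> d \<in> T}" using assms(3) by simp
    ultimately show ?thesis
      using diff_card_le_card_Diff[OF assms(5), of "(\<lambda>a. a \<ominus> b) ` T"]
        card_mono[of "{d \<in> D - E. b \<oplus> d \<in> T}" "(\<lambda>a. a \<ominus> b) ` T - E"] by linarith
  qed
  have "card T * (card T - card E) \<le> (\<Sum>b\<in>T. card {d \<in> D - E. b \<oplus> d \<in> T})"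
    using sum_mono[OF fiber] by simp
  also have "\<dots> = (\<Sum>d\<in>D - E. card {b \<in> T. b \<oplus> d \<in> T})"
    using assms(1,3) by (intro sum_multicount_gen) auto
  finally have lower: "card T * (card T - card E) \<le> (\<Sum>d\<in>D - E. card {b \<in> T. b \<oplus> d \<in> T})" .
  \<comment> \<open>The strict inequality for each \<open>d\<close> survives summation only if there
    is some \<open>d\<close>.\<close>
  have "D - E \<noteq> {}"
  proof
    assume empty: "D - E = {}"
    have "card T * (card T - card E) \<le> 0" using lower unfolding empty sum.empty .
    then show False using assms(6) by simp
  qed
  have "card D * (\<Sum>d\<in>D - E. card {b \<in> T. b \<oplus> d \<in> T})
      < (\<Sum>d\<in>D - E. card T * (card T - card E))"
    unfolding sum_distrib_left using assms(3) \<open>D - E \<noteq> {}\<close> less by (intro sum_strict_mono) auto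
  also have "\<dots> \<le> card D * (card T * (card T - card E))"
    using card_mono[OF assms(3), of "D - E"] by (simp add: mult_right_mono)
  finally show False using mult_le_mono2[OF lower, of "card D"] by simp
qed

text \<open>Steps are chosen from the tail of the list to its head, and the forbidden set may depend
  on those chosen before. \<open>proper_cube\<close> corresponds to forbidding the differences of
  the cube built so far; a general \<open>E\<close> leaves room for further constraints.\<close>

primrec avoiding :: "('a list \<Rightarrow> 'a set) \<Rightarrow> 'a list \<Rightarrow> bool" where
  "avoiding E [] \<longleftrightarrow> True"
| "avoiding E (d # ds) \<longleftrightarrow> d \<in> carrier G \<and> d \<notin> E ds \<and> avoiding E ds"

lemma avoiding_imp_carrier: "avoiding E ds \<Longrightarrow> set ds \<subseteq> carrier G"
  by (induction ds) auto

lemma avoiding_imp_proper_cube: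
  "\<lbrakk>avoiding E ds; \<And>ds. difference_set G (cube ds) \<subseteq> E ds\<rbrakk> \<Longrightarrow> proper_cube ds"
  by (induction ds) auto

text \<open>Each new step is a popular difference of the set \<open>T'\<close> of current base
  points. The bound \<open>large\<close> keeps \<open>card T'\<close> at least \<open>2 * e\<close>,
  so avoiding \<open>e\<close> values costs at most a factor \<open>2\<close>. The exponent of
  \<open>4 * K\<close> goes from \<open>p\<close> to \<open>2 * p + 1\<close>, which from
  \<open>0\<close> yields \<open>2 ^ i - 1\<close>.\<close>

lemma many_translates_of_avoiding_cube:
  fixes K :: real
  assumes "finite S" "S \<noteq> {}" "S \<subseteq> carrier G" "T \<subseteq> S" "card S \<le> 2 * card T"
    and K: "real (card (difference_set G S)) = K * card S"
    and E: "\<And>ds. \<lbrakk>avoiding E ds; length ds < n\<rbrakk> \<Longrightarrow> finite (E ds) \<and> card (E ds) \<le> e"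
    and large: "(4 * K) ^ (2 ^ n - 1) * (4 * real e) \<le> card S" and "e > 0"
  shows "i \<le> n \<Longrightarrow> \<exists>ds. length ds = i \<and> avoiding E ds \<and>
    card S \<le> 2 * (4 * K) ^ (2 ^ i - 1) * card {x \<in> T. \<forall>v\<in>cube ds. v \<oplus> x \<in> T}"
proof (induction i)
  case 0
  \<comment> \<open>With no steps every point of \<open>T\<close> is a base point; the factor
    \<open>2\<close> of the bound is the density of \<open>T\<close> in \<open>S\<close>.\<close>
  have "{x \<in> T. \<forall>v\<in>cube []. v \<oplus> x \<in> T} = T"
    using assms(3,4) by (auto simp: cube_Nil)
  then show ?case using assms(5) by (intro exI[of _ "[]"]) simp
next
  case (Suc i)
  define s where "s = real (card S)"
  have "s > 0" using assms(1,2) by (simp add: s_def card_gt_0_iff)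
  have "s \<le> K * s" using card_le_card_difference_set[OF assms(1,3)] K by (simp add: s_def)
  then have "K \<ge> 1" using \<open>s > 0\<close> by (simp add: mult_le_cancel_right1)
  obtain ds where ds: "length ds = i" "avoiding E ds"
    "s \<le> 2 * (4 * K) ^ (2 ^ i - 1) * card {x \<in> T. \<forall>v\<in>cube ds. v \<oplus> x \<in> T}"
    using Suc by (auto simp: s_def)
  define T' where "T' = {x \<in> T. \<forall>v\<in>cube ds. v \<oplus> x \<in> T}"
  define p :: nat where "p = 2 ^ i - 1"
  have finT: "finite T" using assms(1,4) finite_subset by auto
  have T': "finite T'" "T' \<subseteq> carrier G" "difference_set G T' \<subseteq> difference_set G S"
    using finT assms(3,4) by (auto simp: T'_def difference_set_def)
  have sT': "s \<le> 2 * (4 * K) ^ p * card T'" using ds(3) by (simp add: T'_def p_def)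
  have Ef: "finite (E ds)" "card (E ds) \<le> e" using E[of ds] ds Suc.prems by auto
  \<comment> \<open>Since \<open>K \<ge> 1\<close>, the size condition for the final exponent
    implies the one for the present stage.\<close>
  have "p \<le> 2 ^ n - 1"
    unfolding p_def using Suc.prems by (intro diff_le_mono power_increasing) auto
  then have "(4 * K) ^ p * (4 * real e) \<le> (4 * K) ^ (2 ^ n - 1) * (4 * real e)"
    using \<open>K \<ge> 1\<close> by (intro mult_right_mono power_increasing) auto
  also have "\<dots> \<le> (4 * K) ^ p * (2 * card T')"
    using large sT' by (simp add: s_def mult_ac)
  finally have "4 * real e \<le> 2 * card T'"
    using \<open>K \<ge> 1\<close> by (simp del: of_nat_mult)
  then have eT': "2 * e \<le> card T'" by linarith
  then have "card (E ds) < card T'" using Ef \<open>e > 0\<close> by linarith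
  then obtain d where d: "d \<in> difference_set G S - E ds" and
    popular: "card T' * (card T' - card (E ds)) \<le>
      card (difference_set G S) * card {b \<in> T'. b \<oplus> d \<in> T'}"
    using popular_difference[OF T'(1,2) finite_difference_set[OF assms(1)] T'(3) Ef(1)] by blast
  have dc: "d \<in> carrier G" using d difference_set_carrier[OF assms(3)] by auto
  define T'' where "T'' = {x \<in> T. \<forall>v\<in>cube (d # ds). v \<oplus> x \<in> T}"
  have cube: "cube ds \<subseteq> carrier G"
    using ds(2) by (simp add: cube_carrier avoiding_imp_carrier)
  \<comment> \<open>If the smaller cube fits at both \<open>b\<close> and
    \<open>b \<oplus> d\<close>, then the enlarged cube fits at \<open>b\<close>.\<close>
  have "{b \<in> T'. b \<oplus> d \<in> T'} \<subseteq> T''"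
  proof
    fix b assume b: "b \<in> {b \<in> T'. b \<oplus> d \<in> T'}"
    have "v \<oplus> d \<oplus> b = v \<oplus> (b \<oplus> d)" if "v \<in> cube ds" for v
      using that b cube dc T'(2) by (auto simp: a_ac subset_iff)
    with b show "b \<in> T''" by (auto simp: T'_def T''_def cube_Cons)
  qed
  then have "card {b \<in> T'. b \<oplus> d \<in> T'} \<le> card T''"
    using finT by (intro card_mono) (auto simp: T''_def)
  then have "card T' * (card T' - card (E ds)) \<le> card (difference_set G S) * card T''"
    using popular by (meson le_trans mult_le_mono2)
  then have "real (card T' * (card T' - card (E ds))) \<le> K * s * card T''"
    using K by (metis of_nat_le_iff of_nat_mult s_def)
  moreover have "real (card T') * card T' \<le> 2 * real (card T' * (card T' - card (E ds)))"
  proof -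
    have "card T' \<le> 2 * (card T' - card (E ds))" using eT' Ef(2) by linarith
    then have "card T' * card T' \<le> 2 * (card T' * (card T' - card (E ds)))"
      by (metis mult.left_commute mult_le_mono2)
    then show ?thesis by (metis of_nat_le_iff of_nat_mult of_nat_numeral)
  qed
  ultimately have T'sq: "real (card T') * card T' \<le> 2 * K * s * card T''" by simp
  \<comment> \<open>Squaring introduces \<open>card T'\<close> squared, to which \<open>T'sq\<close>
    applies. Both sides then contain a factor \<open>s\<close>, and the constant
    \<open>8 * K\<close> supplies the factor \<open>2\<close> and one more
    \<open>4 * K\<close>.\<close>
  have "s * s \<le> (2 * (4 * K) ^ p * card T') * (2 * (4 * K) ^ p * card T')"
    using sT' \<open>s > 0\<close> \<open>K \<ge> 1\<close> by (intro mult_mono) auto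
  also have "\<dots> = 4 * (4 * K) ^ p * (4 * K) ^ p * (real (card T') * card T')"
    by (simp add: mult_ac)
  also have "\<dots> \<le> 4 * (4 * K) ^ p * (4 * K) ^ p * (2 * K * s * card T'')"
    using T'sq \<open>K \<ge> 1\<close> by (intro mult_left_mono) auto
  also have "\<dots> = s * (2 * (4 * K) ^ (p + p + 1) * card T'')"
    by (simp add: power_add)
  finally have "s \<le> 2 * (4 * K) ^ (p + p + 1) * card T''"
    using \<open>s > 0\<close> by (simp only: mult_le_cancel_left_pos)
  moreover have "p + p + 1 = 2 ^ Suc i - 1"
  proof -
    have "(1 :: nat) \<le> 2 ^ i" by simp
    then show ?thesis unfolding p_def power_Suc by arith
  qed
  ultimately have "card S \<le> 2 * (4 * K) ^ (2 ^ Suc i - 1) * card T''"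
    unfolding s_def by metis
  then show ?case
    using ds d dc unfolding T''_def by (intro exI[of _ "d # ds"]) auto
qed

end

subsection \<open>Sets with equal power sums\<close>

lemma ring_char_multiple_one_ne_zero:
  assumes "ring_char R = 0 \<or> ring_char R > n" "0 < i" "i \<le> n"
  shows "[i] \<cdot>\<^bsub>R\<^esub> \<one>\<^bsub>R\<^esub> \<noteq> \<zero>\<^bsub>R\<^esub>"
proof
  assume i: "[i] \<cdot>\<^bsub>R\<^esub> \<one>\<^bsub>R\<^esub> = \<zero>\<^bsub>R\<^esub>"
  let ?P = "\<lambda>n::nat. n > 0 \<and> [n] \<cdot>\<^bsub>R\<^esub> \<one>\<^bsub>R\<^esub> = \<zero>\<^bsub>R\<^esub>"
  have "ring_char R = (LEAST n. ?P n)"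
    unfolding ring_char_def by (rule if_P) (use i assms(2) in blast)
  moreover have "?P (LEAST n. ?P n)"
    by (rule LeastI[of ?P i]) (use i assms(2) in auto)
  moreover have "(LEAST n. ?P n) \<le> i"
    by (rule Least_le) (use i assms(2) in auto)
  ultimately show False using assms by auto
qed

text \<open>The factorial multiple of \<open>\<one>\<close> is a product of multiples
  \<open>[j] \<cdot> \<one>\<close> with \<open>j \<le> n\<close>. These are nonzero by the
  assumption on the characteristic, and there are no zero divisors.\<close>

lemma (in domain) fact_multiple_one_ne_zero:
  assumes "ring_char R = 0 \<or> ring_char R > n"
  shows "i \<le> n \<Longrightarrow> [(fact i :: nat)] \<cdot> \<one> \<noteq> \<zero>"
proof (induction i)
  case (Suc i)
  have "[Suc i] \<cdot> \<one> \<noteq> \<zero>"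
    using Suc.prems assms by (intro ring_char_multiple_one_ne_zero) auto
  moreover have "[(fact i :: nat)] \<cdot> \<one> \<noteq> \<zero>" using Suc by simp
  moreover have "[(fact (Suc i) :: nat)] \<cdot> \<one> = ([Suc i] \<cdot> \<one>) \<otimes> ([(fact i :: nat)] \<cdot> \<one>)"
    by (simp add: add_pow_ldistr add.nat_pow_pow mult.commute del: add.nat_pow_Suc)
  ultimately show ?case
    by (metis add.nat_pow_closed integral one_closed)
qed simp

section \<open>Pairs of cube halves and their unions\<close>

context rng
begin

lemma power_sum_closed: "A \<subseteq> carrier R \<Longrightarrow> power_sum R j A \<in> carrier R"
  unfolding power_sum_def by (intro finsum_closed) (auto simp: rng_pow_closed)

lemma power_sum_Un_disjoint:
  "\<lbrakk>finite A; finite B; A \<inter> B = {}; A \<subseteq> carrier R; B \<subseteq> carrier R\<rbrakk>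
    \<Longrightarrow> power_sum R j (A \<union> B) = power_sum R j A \<oplus> power_sum R j B"
  unfolding power_sum_def by (intro finsum_Un_disjoint) (auto simp: rng_pow_closed)

text \<open>\<open>P\<close> and \<open>Q\<close> are the two halves of a translated cube of
  dimension \<open>k + 1\<close>. \<open>U\<close> holds elements already used and \<open>B\<close>
  the values to be avoided. The budget \<open>e\<close> bounds both \<open>U\<close> and the number
  of steps forbidden at each stage.\<close>

lemma exists_equal_power_sums_pair:
  fixes K :: real
  assumes S: "finite S" "S \<noteq> {}" "S \<subseteq> carrier R"
    and K: "real (card (difference_set R S)) = K * card S"
    and large: "(4 * K) ^ (2 ^ (k + 1) - 1) * (4 * real e) \<le> card S"
    and U: "finite U" "card U \<le> e"
    and B: "finite B" "4 ^ k + card B \<le> e"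
  obtains P Q where "P \<subseteq> S - U" "Q \<subseteq> S - U" "P \<inter> Q = {}" "card P = 2 ^ k" "card Q = 2 ^ k"
    "\<forall>j\<in>{1..k}. power_sum R j P = power_sum R j Q"
    "domain R \<and> (ring_char R = 0 \<or> ring_char R > k + 1) \<Longrightarrow>
      power_sum R (k + 1) P \<ominus> power_sum R (k + 1) Q \<notin> B"
proof -
  define separating where
    "separating \<longleftrightarrow> domain R \<and> (ring_char R = 0 \<or> ring_char R > k + 1)"
  \<comment> \<open>In a commutative ring this is the \<open>(k + 1)\<close>-fold difference of the
    power \<open>k + 1\<close>, when \<open>ds\<close> has length \<open>k + 1\<close>.\<close>
  define lead where "lead ds = ([(fact (k + 1) :: nat)] \<cdot> \<one>) \<otimes> foldr (\<otimes>) ds \<one>" for ds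
  \<comment> \<open>The first part forces the cube to be proper. At the last step the second part
    keeps the difference of the two power sums of exponent \<open>k + 1\<close> out of
    \<open>B\<close>.\<close>
  define E where "E ds = difference_set R (cube ds) \<union>
    (if separating then {d \<in> carrier R. lead (d # ds) \<in> B} else {})" for ds
  have "e > 0" using B(2) by (metis add_is_0 gr0I le_zero_eq power_eq_0_iff zero_neq_numeral)
  \<comment> \<open>Zero is a difference of any vertex with itself, so it is always forbidden. The
    product of the steps is then nonzero in a domain.\<close>
  have nonzero: "\<zero> \<notin> set ds" if "avoiding E ds" for ds
    using that
  proof (induction ds)
    case (Cons d ds)
    have "\<zero> \<ominus> \<zero> \<in> difference_set R (cube ds)"
      using zero_in_cube by (auto simp: difference_set_def)
    then have "\<zero> \<in> E ds"
      by (simp add: E_def minus_eq a_inv_zero)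
    with Cons show ?case by auto
  qed simp
  have E: "finite (E ds) \<and> card (E ds) \<le> e" if ds: "avoiding E ds" "length ds < k + 1" for ds
  proof -
    \<comment> \<open>Every cube that is still to be extended has dimension at most
      \<open>k\<close>, hence at most \<open>2 ^ k\<close> vertices and \<open>4 ^ k\<close>
      differences.\<close>
    have "card (difference_set R (cube ds)) \<le> (2 ^ length ds)\<^sup>2"
      using card_difference_set_le[OF finite_cube] card_cube_le
      by (rule order_trans[OF _ power_mono]) auto
    also have "\<dots> = 4 ^ length ds" by (simp add: power2_eq_square flip: power_mult_distrib)
    also have "\<dots> \<le> 4 ^ k" using ds(2) by (intro power_increasing) auto
    finally have "card (difference_set R (cube ds)) \<le> 4 ^ k" .
    moreover have "finite {d \<in> carrier R. lead (d # ds) \<in> B} \<and>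
      card {d \<in> carrier R. lead (d # ds) \<in> B} \<le> card B" if separating
    proof -
      interpret domain R using that by (simp add: separating_def)
      have "set ds \<subseteq> carrier R" using avoiding_imp_carrier[OF ds(1)] .
      with nonzero[OF ds(1)] have prod: "foldr (\<otimes>) ds \<one> \<in> carrier R \<and> foldr (\<otimes>) ds \<one> \<noteq> \<zero>"
        by (induction ds) (auto simp: integral_iff)
      define F where "F = [(fact (k + 1) :: nat)] \<cdot> \<one>"
      have "F \<noteq> \<zero>"
        unfolding F_def using that fact_multiple_one_ne_zero[of "k + 1" "k + 1"]
        by (simp add: separating_def del: fact_Suc)
      moreover have "F \<in> carrier R" by (simp add: F_def)
      moreover have "lead (d # ds) = F \<otimes> (d \<otimes> foldr (\<otimes>) ds \<one>)" for d
        by (simp only: lead_def F_def foldr.simps o_apply)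
      \<comment> \<open>\<open>lead\<close> is multiplication of \<open>d\<close> by nonzero
        factors, so each value in \<open>B\<close> excludes at most one \<open>d\<close>.\<close>
      ultimately have "inj_on (\<lambda>d. lead (d # ds)) (carrier R)"
        using prod by (intro inj_onI) (simp add: m_lcancel m_rcancel)
      then have "inj_on (\<lambda>d. lead (d # ds)) {d \<in> carrier R. lead (d # ds) \<in> B}"
        by (rule inj_on_subset) auto
      then show ?thesis
        using B(1) by (auto intro: inj_on_finite card_inj_on_le)
    qed
    ultimately show ?thesis
      using B(2) card_Un_le[of "difference_set R (cube ds)" "{d \<in> carrier R. lead (d # ds) \<in> B}"]
        finite_difference_set[OF finite_cube]
      unfolding E_def by auto
  qed
  have "K \<ge> 1"
  proof -
    have "real (card S) \<le> K * card S"
      using card_le_card_difference_set[OF S(1,3)] K by linarith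
    then show ?thesis using S by (simp add: mult_le_cancel_right1 card_gt_0_iff)
  qed
  \<comment> \<open>As \<open>K \<ge> 1\<close>, the size condition gives
    \<open>4 * e \<le> card S\<close>, so deleting \<open>U\<close> leaves well over half of
    \<open>S\<close>.\<close>
  have "4 * real e \<le> (4 * K) ^ (2 ^ (k + 1) - 1) * (4 * real e)"
    using \<open>K \<ge> 1\<close> one_le_power[of "4 * K"] by (simp add: mult_le_cancel_right1)
  then have "4 * e \<le> card S" using large by linarith
  then have "card S \<le> 2 * card (S - U)"
    using U diff_card_le_card_Diff[OF U(1), of S] by linarith
  then obtain ds where ds: "length ds = k + 1" "avoiding E ds" and
    "card S \<le> 2 * (4 * K) ^ (2 ^ (k + 1) - 1) * card {x \<in> S - U. \<forall>v\<in>cube ds. v \<oplus> x \<in> S - U}"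
    using many_translates_of_avoiding_cube[where E = E and T = "S - U",
      OF S _ _ K E large \<open>e > 0\<close> order.refl] by blast
  moreover have "card S > 0" using S by (simp add: card_gt_0_iff)
  ultimately have "card {x \<in> S - U. \<forall>v\<in>cube ds. v \<oplus> x \<in> S - U} \<noteq> 0"
    by (intro notI) simp
  then have "{x \<in> S - U. \<forall>v\<in>cube ds. v \<oplus> x \<in> S - U} \<noteq> {}"
    by (intro notI) (simp only: card.empty)
  then obtain x where x: "x \<in> carrier R" "\<And>v. v \<in> cube ds \<Longrightarrow> v \<oplus> x \<in> S - U"
    using S(3) by auto
  have proper: "proper_cube ds"
    using ds(2) by (rule avoiding_imp_proper_cube) (auto simp: E_def)
  have dsc: "set ds \<subseteq> carrier R" using ds(2) by (rule avoiding_imp_carrier)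
  define H where "H b = (\<lambda>v. v \<oplus> x) ` cube_half ds b" for b
  have inj: "inj_on (\<lambda>v. v \<oplus> x) (cube ds)"
    using x(1) cube_carrier[OF dsc] by (intro inj_on_translate)
  have sub: "H b \<subseteq> S - U" for b
    using x(2) cube_half_subset_cube by (auto simp: H_def)
  have cardH: "card (H b) = 2 ^ k" for b
    using card_cube_half[OF proper, of k b] ds(1) inj_on_subset[OF inj cube_half_subset_cube]
    by (simp add: H_def card_image)
  have disj: "H True \<inter> H False = {}"
    using inj_on_image_Int[OF inj cube_half_subset_cube cube_half_subset_cube, of True False]
      cube_half_disjoint[OF proper, of True] by (simp add: H_def)
  have Hc: "H b \<subseteq> carrier R" for b using sub S(3) by blast
  have diff: "power_sum R j (H True) \<ominus> power_sum R j (H False) = iter_diff ds (\<lambda>x. rng_pow R x j) x" for j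
    unfolding H_def by (rule power_sum_cube_diff[OF proper x(1)])
  have eq: "power_sum R j (H True) = power_sum R j (H False)" if "j \<in> {1..k}" for j
  proof -
    have "power_sum R j (H True) \<ominus> power_sum R j (H False) = \<zero>"
      unfolding diff using that ds(1) dsc x(1) by (intro iter_diff_rng_pow_eq_zero) auto
    then show ?thesis by (rule eq_if_minus_eq_zero[OF power_sum_closed[OF Hc] power_sum_closed[OF Hc]])
  qed
  have sep: "power_sum R (k + 1) (H True) \<ominus> power_sum R (k + 1) (H False) \<notin> B" if separating
  proof -
    interpret domain R using that by (simp add: separating_def)
    obtain d es where des: "ds = d # es" using ds(1) by (cases ds) auto
    have "iter_diff ds (\<lambda>x. rng_pow R x (k + 1)) x = lead ds"
      unfolding lead_def using dsc ds(1) x(1) by (intro iter_diff_rng_pow_leading) auto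
    moreover have "lead ds \<notin> B"
      using ds(2) that by (auto simp: des E_def)
    ultimately show ?thesis by (simp add: diff)
  qed
  show ?thesis
    using that[OF sub sub disj cardH cardH] eq sep by (auto simp: separating_def)
qed

text \<open>\<open>F\<close> collects the unions of one half from each of \<open>i\<close> disjoint
  cubes. A new cube doubles \<open>F\<close> and uses \<open>2 ^ (k + 1)\<close> further elements.
  The two bounds on \<open>e\<close> pay for the elements used and for the at most
  \<open>4 ^ l\<close> differences of power sums to be avoided.\<close>

lemma exists_equal_power_sums_sets:
  fixes K :: real
  assumes S: "finite S" "S \<noteq> {}" "S \<subseteq> carrier R"
    and K: "real (card (difference_set R S)) = K * card S"
    and large: "(4 * K) ^ (2 ^ (k + 1) - 1) * (4 * real e) \<le> card S"
    and e: "4 ^ k + 4 ^ l \<le> e" "l * 2 ^ (k + 1) \<le> e"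
  shows "i \<le> l \<Longrightarrow> \<exists>F. finite F \<and> card F = 2 ^ i \<and> (\<forall>A\<in>F. A \<subseteq> S \<and> card A = i * 2 ^ k) \<and>
    card (\<Union>F) \<le> i * 2 ^ (k + 1) \<and>
    (\<forall>A\<in>F. \<forall>B\<in>F. \<forall>j\<in>{1..k}. power_sum R j A = power_sum R j B) \<and>
    (domain R \<and> (ring_char R = 0 \<or> ring_char R > k + 1) \<longrightarrow> inj_on (power_sum R (k + 1)) F)"
proof (induction i)
  case 0
  \<comment> \<open>With no cubes there is exactly one choice, the empty set.\<close>
  show ?case by (intro exI[of _ "{{}}"]) auto
next
  case (Suc i)
  define separating where
    "separating \<longleftrightarrow> domain R \<and> (ring_char R = 0 \<or> ring_char R > k + 1)"
  obtain F where F0: "finite F \<and> card F = 2 ^ i \<and> (\<forall>A\<in>F. A \<subseteq> S \<and> card A = i * 2 ^ k) \<and>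
    card (\<Union>F) \<le> i * 2 ^ (k + 1) \<and>
    (\<forall>A\<in>F. \<forall>B\<in>F. \<forall>j\<in>{1..k}. power_sum R j A = power_sum R j B) \<and>
    (separating \<longrightarrow> inj_on (power_sum R (k + 1)) F)"
    using Suc.IH[OF Suc_leD[OF Suc.prems]] unfolding separating_def by blast
  then have F: "finite F" "card F = 2 ^ i" "\<And>A. A \<in> F \<Longrightarrow> A \<subseteq> S"
    "\<And>A. A \<in> F \<Longrightarrow> card A = i * 2 ^ k" "card (\<Union>F) \<le> i * 2 ^ (k + 1)"
    "\<And>A B j. \<lbrakk>A \<in> F; B \<in> F; j \<in> {1..k}\<rbrakk> \<Longrightarrow> power_sum R j A = power_sum R j B"
    "separating \<Longrightarrow> inj_on (power_sum R (k + 1)) F"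
    by blast+
  \<comment> \<open>\<open>A \<union> P\<close> and \<open>A' \<union> Q\<close> have equal \<open>(k+1)\<close>-th power sums only if those of \<open>P\<close> and \<open>Q\<close>
    differ by an element of \<open>B\<close>.\<close>
  define B where "B = difference_set R (power_sum R (k + 1) ` F)"
  have "card B \<le> (card F)\<^sup>2"
    unfolding B_def using F(1)
    by (intro order_trans[OF card_difference_set_le power_mono]) (auto intro: card_image_le)
  also have "\<dots> = 4 ^ i" by (simp add: F(2) power2_eq_square flip: power_mult_distrib)
  also have "\<dots> \<le> 4 ^ l" using Suc.prems by (intro power_increasing) auto
  finally have cardB: "4 ^ k + card B \<le> e" using e(1) by linarith
  have "card (\<Union>F) \<le> l * 2 ^ (k + 1)"
    using F(5) Suc.prems by (meson Suc_leD le_trans mult_le_mono1)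
  then have cardU: "card (\<Union>F) \<le> e" using e(2) by linarith
  have finU: "finite (\<Union>F)"
    using F(3) S(1) by (meson Sup_least finite_subset)
  obtain P Q where PQ: "P \<subseteq> S - \<Union>F" "Q \<subseteq> S - \<Union>F" "P \<inter> Q = {}" "card P = 2 ^ k" "card Q = 2 ^ k"
    "\<forall>j\<in>{1..k}. power_sum R j P = power_sum R j Q"
    "separating \<Longrightarrow> power_sum R (k + 1) P \<ominus> power_sum R (k + 1) Q \<notin> B"
    using exists_equal_power_sums_pair[OF S K large finU cardU _ cardB] F(1)
    by (metis B_def finite_difference_set finite_imageI separating_def)
  have "P \<noteq> Q" using PQ(3,4) by auto
  have X: "X \<subseteq> S - \<Union>F" "finite X" "card X = 2 ^ k" "X \<subseteq> carrier R" if "X \<in> {P, Q}" for X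
    using that PQ(1,2,4,5) S(1,3) by (auto intro: finite_subset)
  have A: "finite A" "A \<subseteq> carrier R" if "A \<in> F" for A
    using F(3)[OF that] S(1,3) by (auto intro: finite_subset)
  have AX: "A \<inter> X = {}" if "A \<in> F" "X \<in> {P, Q}" for A X
    using X(1)[OF that(2)] that(1) by auto
  have ps: "power_sum R j (A \<union> X) = power_sum R j A \<oplus> power_sum R j X"
    if "A \<in> F" "X \<in> {P, Q}" for A X j
    using A[OF that(1)] X[OF that(2)] AX[OF that] by (intro power_sum_Un_disjoint)
  define F' where "F' = (\<lambda>(A, X). A \<union> X) ` (F \<times> {P, Q})"
  have "inj_on (\<lambda>(A, X). A \<union> X) (F \<times> {P, Q})"
  proof (rule inj_onI, clarify)
    fix A X A' X' assume h: "A \<in> F" "A' \<in> F" "X \<in> {P, Q}" "X' \<in> {P, Q}" "A \<union> X = A' \<union> X'"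
    \<comment> \<open>The new halves are disjoint from everything used before, so intersecting with
      \<open>\<Union>F\<close> and removing it recover both parts of the union.\<close>
    have "A = (A \<union> X) \<inter> \<Union>F" "X = (A \<union> X) - \<Union>F" "A' = (A' \<union> X') \<inter> \<Union>F" "X' = (A' \<union> X') - \<Union>F"
      using h(1,2) X(1)[OF h(3)] X(1)[OF h(4)] by auto
    then show "A = A' \<and> X = X'" using h(5) by metis
  qed
  then have "card F' = 2 ^ Suc i"
    using \<open>P \<noteq> Q\<close> F(2) by (simp add: F'_def card_image card_cartesian_product)
  moreover have "finite F'" using F(1) by (simp add: F'_def)
  moreover have "\<forall>C\<in>F'. C \<subseteq> S \<and> card C = Suc i * 2 ^ k"
  proof
    fix C assume "C \<in> F'"
    then obtain A X where C: "C = A \<union> X" "A \<in> F" "X \<in> {P, Q}" by (auto simp: F'_def)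
    then show "C \<subseteq> S \<and> card C = Suc i * 2 ^ k"
      using F(3,4)[OF C(2)] A[OF C(2)] X[OF C(3)] AX[OF C(2,3)] by (auto simp: card_Un_disjoint)
  qed
  moreover have "card (\<Union>F') \<le> Suc i * 2 ^ (k + 1)"
  proof -
    have "card (\<Union>F') \<le> card (\<Union>F \<union> (P \<union> Q))"
      using finU X(2) by (intro card_mono) (auto simp: F'_def)
    also have "\<dots> \<le> card (\<Union>F) + (card P + card Q)"
      by (meson card_Un_le le_trans add_left_mono)
    finally show ?thesis using F(5) PQ(4,5) by simp
  qed
  moreover have "\<forall>C\<in>F'. \<forall>C'\<in>F'. \<forall>j\<in>{1..k}. power_sum R j C = power_sum R j C'"
  proof (intro ballI)
    fix C C' j assume h: "C \<in> F'" "C' \<in> F'" "j \<in> {1..k}"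
    then obtain A X A' X' where C: "C = A \<union> X" "A \<in> F" "X \<in> {P, Q}"
      and C': "C' = A' \<union> X'" "A' \<in> F" "X' \<in> {P, Q}" by (auto simp: F'_def)
    have "power_sum R j X = power_sum R j X'"
      using C(3) C'(3) PQ(6) h(3) by auto
    then show "power_sum R j C = power_sum R j C'"
      using ps[OF C(2,3)] ps[OF C'(2,3)] F(6)[OF C(2) C'(2) h(3)] by (simp add: C(1) C'(1))
  qed
  moreover have "inj_on (power_sum R (k + 1)) F'" if separating
  proof (rule inj_onI)
    fix C C' assume h: "C \<in> F'" "C' \<in> F'" "power_sum R (k + 1) C = power_sum R (k + 1) C'"
    then obtain A X A' X' where C: "C = A \<union> X" "A \<in> F" "X \<in> {P, Q}"
      and C': "C' = A' \<union> X'" "A' \<in> F" "X' \<in> {P, Q}" by (auto simp: F'_def)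
    let ?p = "power_sum R (k + 1)"
    have sum_eq: "?p A \<oplus> ?p X = ?p A' \<oplus> ?p X'"
      using h(3) ps[OF C(2,3)] ps[OF C'(2,3)] by (simp add: C(1) C'(1))
    have cl: "?p A \<in> carrier R" "?p A' \<in> carrier R" "?p X \<in> carrier R" "?p X' \<in> carrier R"
      using A(2) X(4) C C' power_sum_closed by auto
    \<comment> \<open>Both orders are needed, since \<open>X\<close> and \<open>X'\<close> may be
      \<open>P\<close> and \<open>Q\<close> or the reverse, and \<open>B\<close> excludes only the
      difference of \<open>P\<close> minus \<open>Q\<close>.\<close>
    have "?p X \<ominus> ?p X' = ?p A' \<ominus> ?p A" "?p X' \<ominus> ?p X = ?p A \<ominus> ?p A'"
      using minus_eq_minus_if_add_eq_add cl sum_eq by metis+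
    then have "?p X \<ominus> ?p X' \<in> B" "?p X' \<ominus> ?p X \<in> B"
      using C(2) C'(2) by (auto simp: B_def difference_set_def)
    then have "X = X'" using C(3) C'(3) PQ(7)[OF that] by auto
    then have "?p A = ?p A'" using sum_eq cl by simp
    then have "A = A'" using F(7)[OF that] C(2) C'(2) by (auto dest: inj_onD)
    with \<open>X = X'\<close> show "C = C'" by (simp add: C(1) C'(1))
  qed
  ultimately show ?case unfolding separating_def by blast
qed

end

section \<open>The value of the constant\<close>

lemma le_two_power_nat_ceiling_log:
  assumes "m \<ge> 1"
  shows "m \<le> 2 ^ nat \<lceil>log 2 (real m)\<rceil>"
proof -
  have "log 2 m \<le> real (nat \<lceil>log 2 (real m)\<rceil>)" by linarith
  then have "real m \<le> 2 powr real (nat \<lceil>log 2 (real m)\<rceil>)"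
    using assms by (simp add: le_powr_iff)
  then have "real m \<le> real (2 ^ nat \<lceil>log 2 (real m)\<rceil>)"
    by (simp add: powr_realpow)
  then show ?thesis by (simp only: of_nat_le_iff)
qed

lemma exists_admissible_constant:
  assumes "m \<ge> 2"
  shows "\<exists>c>0. \<forall>R :: ('a, 'b) ring_scheme. rng R \<longrightarrow> admissible_constant k m c R"
proof (intro exI conjI allI impI)
  define l where "l = nat \<lceil>log 2 (real m)\<rceil>"
  \<comment> \<open>The sum meets both demands on the budget for \<open>l\<close> cubes and depends
    on \<open>k\<close> and \<open>m\<close> only.\<close>
  define e :: nat where "e = 4 ^ k + 4 ^ l + l * 2 ^ (k + 1)"
  define M :: nat where "M = 2 ^ (k + 1) - 1"
  have "M > 0" unfolding M_def using one_less_power[of "2::nat" "k + 1"] by simp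
  have realM: "real M = 2 ^ (k + 1) - 1"
    unfolding M_def by (subst of_nat_diff) (auto simp del: power_Suc)
  have "e > 0" by (simp add: e_def)
  \<comment> \<open>This solves \<open>(4 * K) ^ M * (4 * e) \<le> card S\<close> for
    \<open>K\<close>, leaving out the factor \<open>card S powr (1 / M)\<close>.\<close>
  let ?c = "1 / 4 * (1 / (4 * real e)) powr (1 / M)"
  show "?c > 0" using \<open>e > 0\<close> by simp
  fix R :: "('a, 'b) ring_scheme" assume "rng R"
  then interpret rng R .
  show "admissible_constant k m ?c R"
    unfolding admissible_constant_def
  proof (intro allI impI)
    fix S K assume "S \<subseteq> carrier R \<and> finite S \<and> S \<noteq> {} \<and>
      real (card (difference_set R S)) = K * real (card S) \<and>
      K \<le> ?c * real (card S) powr (1 / (2 ^ (k + 1) - 1))"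
    then have S: "finite S" "S \<noteq> {}" "S \<subseteq> carrier R"
      and K: "real (card (difference_set R S)) = K * real (card S)"
      and le: "K \<le> ?c * real (card S) powr (1 / M)"
      by (auto simp: realM)
    have cS: "card S > 0" using S by (simp add: card_gt_0_iff)
    then have "K \<ge> 0" using K by (metis of_nat_0_le_iff of_nat_0_less_iff zero_le_mult_iff not_le)
    have "4 * K \<le> (1 / (4 * real e)) powr (1 / M) * real (card S) powr (1 / M)"
      using le by simp
    also have "\<dots> = (card S / (4 * real e)) powr (1 / M)"
      by (subst powr_mult[symmetric]) auto
    finally have "(4 * K) ^ M \<le> ((card S / (4 * real e)) powr (1 / M)) ^ M"
      using \<open>K \<ge> 0\<close> by (intro power_mono) auto
    also have "\<dots> = card S / (4 * real e)"
      using \<open>M > 0\<close> cS \<open>e > 0\<close> by (simp add: powr_powr flip: powr_realpow)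
    finally have large: "(4 * K) ^ (2 ^ (k + 1) - 1) * (4 * real e) \<le> card S"
      using \<open>e > 0\<close> by (simp add: pos_le_divide_eq M_def)
    have e: "4 ^ k + 4 ^ l \<le> e" "l * 2 ^ (k + 1) \<le> e" by (auto simp: e_def)
    obtain F where F0: "finite F \<and> card F = 2 ^ l \<and> (\<forall>A\<in>F. A \<subseteq> S \<and> card A = l * 2 ^ k) \<and>
      card (\<Union>F) \<le> l * 2 ^ (k + 1) \<and>
      (\<forall>A\<in>F. \<forall>B\<in>F. \<forall>j\<in>{1..k}. power_sum R j A = power_sum R j B) \<and>
      (domain R \<and> (ring_char R = 0 \<or> ring_char R > k + 1) \<longrightarrow> inj_on (power_sum R (k + 1)) F)"
      using exists_equal_power_sums_sets[OF S K large e order.refl] by (elim exE)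
    then have F: "finite F" "card F = 2 ^ l" "\<And>A. A \<in> F \<Longrightarrow> A \<subseteq> S"
      "\<And>A. A \<in> F \<Longrightarrow> card A = l * 2 ^ k"
      "\<And>A B j. \<lbrakk>A \<in> F; B \<in> F; j \<in> {1..k}\<rbrakk> \<Longrightarrow> power_sum R j A = power_sum R j B"
      "domain R \<and> (ring_char R = 0 \<or> ring_char R > k + 1) \<Longrightarrow> inj_on (power_sum R (k + 1)) F"
      by blast+
    \<comment> \<open>The \<open>2 ^ l\<close> sets in \<open>F\<close> suffice for \<open>m\<close>
      indices. An injective choice of indices gives one family that serves both conclusions.\<close>
    have "card {1..m} \<le> card F"
      using le_two_power_nat_ceiling_log[of m] assms by (simp add: F(2) l_def)
    then obtain A where A: "A ` {1..m} \<subseteq> F" "inj_on A {1..m}"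
      using card_le_inj[of "{1..m}" F] F(1) by auto
    then have AF: "\<And>i. i \<in> {1..m} \<Longrightarrow> A i \<in> F" by auto
    have "1 \<in> {1..m}" using assms by simp
    then have family: "equal_power_sums_family R S k m A"
      unfolding equal_power_sums_family_def l_def[symmetric]
      using AF F(3,4) by (intro conjI ballI F(5)) blast+
    moreover have "power_sum R (k + 1) (A h) \<noteq> power_sum R (k + 1) (A t)"
      if "domain R \<and> (ring_char R = 0 \<or> ring_char R > k + 1)"
        "h \<in> {1..m}" "t \<in> {1..m}" "h \<noteq> t" for h t
      using F(6)[OF that(1)] A(2) AF that(2-4) by (meson inj_onD)
    ultimately show "(\<exists>A. inj_on A {1..m} \<and> equal_power_sums_family R S k m A) \<and>
       (domain R \<and> (ring_char R = 0 \<or> ring_char R > k + 1) \<longrightarrow>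
         (\<exists>A. equal_power_sums_family R S k m A \<and>
           (\<forall>h\<in>{1..m}. \<forall>t\<in>{1..m}. h \<noteq> t \<longrightarrow>
             power_sum R (k + 1) (A h) \<noteq> power_sum R (k + 1) (A t))))"
      using A(2) by blast
  qed
qed

subsection \<open>Transfer to rings of natural numbers\<close>

text \<open>The generated subring is the union of countably many stages, each adding all sums,
  products and negatives of the previous one. The stages increase, so any two elements share a
  stage, and the next stage contains their sum and product.\<close>

lemma (in rng) exists_countable_closed_subset:
  assumes "finite S" "S \<subseteq> carrier R"
  obtains C where "countable C" "S \<subseteq> C" "C \<subseteq> carrier R"
    "\<And>x y. \<lbrakk>x \<in> C; y \<in> C\<rbrakk> \<Longrightarrow> x \<oplus> y \<in> C"
    "\<And>x y. \<lbrakk>x \<in> C; y \<in> C\<rbrakk> \<Longrightarrow> x \<otimes> y \<in> C" "\<And>x. x \<in> C \<Longrightarrow> \<ominus> x \<in> C"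
proof -
  define extend where "extend A = A \<union> (\<lambda>(x, y). x \<oplus> y) ` (A \<times> A) \<union>
    (\<lambda>(x, y). x \<otimes> y) ` (A \<times> A) \<union> (\<lambda>x. \<ominus> x) ` A" for A
  define stage where "stage n = (extend ^^ n) S" for n :: nat
  have stage: "countable (stage n) \<and> stage n \<subseteq> carrier R" for n
  proof (induction n)
    case 0
    then show ?case using assms by (simp add: stage_def countable_finite)
  next
    case (Suc n)
    then show ?case by (auto simp: stage_def extend_def m_closed subset_iff)
  qed
  have step: "stage n \<subseteq> stage (Suc n)" for n
    by (auto simp: stage_def extend_def)
  have mono: "stage i \<subseteq> stage (max i j)" "stage j \<subseteq> stage (max i j)" for i j
    by (rule lift_Suc_mono_le[of stage, OF step], simp)+
  define C where "C = (\<Union>n. stage n)"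
  have common: "\<exists>n. x \<in> stage n \<and> y \<in> stage n" if "x \<in> C" "y \<in> C" for x y
    using that mono unfolding C_def by blast
  have add: "x \<oplus> y \<in> C" if xy: "x \<in> C" "y \<in> C" for x y
  proof -
    obtain n where "x \<in> stage n" "y \<in> stage n" using common[OF xy] by blast
    then have "x \<oplus> y \<in> stage (Suc n)" by (force simp: stage_def extend_def)
    then show ?thesis by (auto simp: C_def)
  qed
  have mult: "x \<otimes> y \<in> C" if xy: "x \<in> C" "y \<in> C" for x y
  proof -
    obtain n where "x \<in> stage n" "y \<in> stage n" using common[OF xy] by blast
    then have "x \<otimes> y \<in> stage (Suc n)" by (force simp: stage_def extend_def)
    then show ?thesis by (auto simp: C_def)
  qed
  have uminus: "\<ominus> x \<in> C" if x: "x \<in> C" for x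
  proof -
    obtain n where "x \<in> stage n" using x by (auto simp: C_def)
    then have "\<ominus> x \<in> stage (Suc n)" by (auto simp: stage_def extend_def)
    then show ?thesis by (auto simp: C_def)
  qed
  have "S \<subseteq> C" unfolding C_def by (auto simp: stage_def intro!: exI[of _ "0 :: nat"])
  then show ?thesis
    using that[of C] stage add mult uminus by (auto simp: C_def)
qed

text \<open>The unit of \<open>copy\<close> is junk unless \<open>\<one> \<in> C\<close>.\<close>

locale subrng_copy = rng R for R (structure) +
  fixes C :: "'a set" and \<phi> :: "'a \<Rightarrow> 'c"
  assumes subset: "C \<subseteq> carrier R" and zero_mem: "\<zero> \<in> C"
    and add_mem: "\<lbrakk>x \<in> C; y \<in> C\<rbrakk> \<Longrightarrow> x \<oplus> y \<in> C"
    and mult_mem: "\<lbrakk>x \<in> C; y \<in> C\<rbrakk> \<Longrightarrow> x \<otimes> y \<in> C"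
    and uminus_mem: "x \<in> C \<Longrightarrow> \<ominus> x \<in> C"
    and inj: "inj_on \<phi> C"
begin

definition copy :: "'c ring" where
  "copy = \<lparr>carrier = \<phi> ` C,
    mult = \<lambda>x y. \<phi> (the_inv_into C \<phi> x \<otimes> the_inv_into C \<phi> y), one = \<phi> \<one>, zero = \<phi> \<zero>,
    add = \<lambda>x y. \<phi> (the_inv_into C \<phi> x \<oplus> the_inv_into C \<phi> y)\<rparr>"

lemma inC: "x \<in> C \<Longrightarrow> x \<in> carrier R"
  using subset by auto

lemma phi_eq_iff: "\<lbrakk>x \<in> C; y \<in> C\<rbrakk> \<Longrightarrow> \<phi> x = \<phi> y \<longleftrightarrow> x = y"
  using inj by (auto dest: inj_onD)

lemma carrier_copy: "carrier copy = \<phi> ` C"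
  and one_copy: "\<one>\<^bsub>copy\<^esub> = \<phi> \<one>"
  and zero_copy: "\<zero>\<^bsub>copy\<^esub> = \<phi> \<zero>"
  by (simp_all add: copy_def)

lemma add_copy: "\<lbrakk>x \<in> C; y \<in> C\<rbrakk> \<Longrightarrow> \<phi> x \<oplus>\<^bsub>copy\<^esub> \<phi> y = \<phi> (x \<oplus> y)"
  and mult_copy: "\<lbrakk>x \<in> C; y \<in> C\<rbrakk> \<Longrightarrow> \<phi> x \<otimes>\<^bsub>copy\<^esub> \<phi> y = \<phi> (x \<otimes> y)"
  using inj by (simp_all add: copy_def the_inv_into_f_f)

lemmas copy_simps = carrier_copy one_copy zero_copy add_copy mult_copy add_mem mult_mem
  uminus_mem zero_mem inC

lemma phi_carrier: "x \<in> C \<Longrightarrow> \<phi> x \<in> carrier copy"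
  by (simp add: carrier_copy)

lemma abelian_group_copy: "abelian_group copy"
proof (rule abelian_groupI)
  fix x assume "x \<in> carrier copy"
  then obtain a where a: "x = \<phi> a" "a \<in> C" by (auto simp: copy_simps)
  then have "\<phi> (\<ominus> a) \<oplus>\<^bsub>copy\<^esub> x = \<zero>\<^bsub>copy\<^esub>" by (simp add: copy_simps l_neg)
  then show "\<exists>y\<in>carrier copy. y \<oplus>\<^bsub>copy\<^esub> x = \<zero>\<^bsub>copy\<^esub>"
    using a(2) by (auto simp: carrier_copy intro: uminus_mem)
qed (auto simp: copy_simps a_ac)

sublocale copy: rng copy
  by (intro rng.intro rng_axioms.intro abelian_group_copy)
    (auto simp: copy_simps l_distr r_distr m_assoc)

lemma uminus_copy: "x \<in> C \<Longrightarrow> \<ominus>\<^bsub>copy\<^esub> \<phi> x = \<phi> (\<ominus> x)"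
  by (rule copy.minus_equality) (auto simp: copy_simps l_neg)

lemma minus_copy: "\<lbrakk>x \<in> C; y \<in> C\<rbrakk> \<Longrightarrow> \<phi> x \<ominus>\<^bsub>copy\<^esub> \<phi> y = \<phi> (x \<ominus> y)"
  by (simp add: a_minus_def uminus_copy copy_simps)

lemma rng_pow_copy: "x \<in> C \<Longrightarrow> rng_pow R x j \<in> C \<and> rng_pow copy (\<phi> x) j = \<phi> (rng_pow R x j)"
proof -
  assume x: "x \<in> C"
  have "((\<lambda>y. y \<otimes> x) ^^ n) x \<in> C \<and>
    ((\<lambda>y. y \<otimes>\<^bsub>copy\<^esub> \<phi> x) ^^ n) (\<phi> x) = \<phi> (((\<lambda>y. y \<otimes> x) ^^ n) x)" for n
    by (induction n) (auto simp: x copy_simps)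
  then show ?thesis by (simp add: rng_pow_def)
qed

lemma power_sum_copy:
  "\<lbrakk>finite A; A \<subseteq> C\<rbrakk> \<Longrightarrow> power_sum R j A \<in> C \<and> power_sum copy j (\<phi> ` A) = \<phi> (power_sum R j A)"
proof (induction A rule: finite_induct)
  case empty
  then show ?case by (simp add: power_sum_def copy_simps)
next
  case (insert a A)
  have aA: "a \<in> C" "A \<subseteq> C" "\<phi> a \<notin> \<phi> ` A"
    using insert.hyps insert.prems inj by (auto simp: inj_on_image_mem_iff)
  have "power_sum R j (insert a A) = rng_pow R a j \<oplus> power_sum R j A"
    unfolding power_sum_def using insert.hyps aA
    by (intro finsum_insert) (auto intro: rng_pow_closed inC)
  moreover have "power_sum copy j (insert (\<phi> a) (\<phi> ` A)) =
      rng_pow copy (\<phi> a) j \<oplus>\<^bsub>copy\<^esub> power_sum copy j (\<phi> ` A)"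
    unfolding power_sum_def using insert.hyps aA
    by (intro copy.finsum_insert) (auto intro!: copy.rng_pow_closed phi_carrier)
  ultimately show ?case
    using insert.IH[OF aA(2)] rng_pow_copy[OF aA(1), of j] by (simp add: copy_simps)
qed

lemma difference_set_copy:
  assumes "S \<subseteq> C"
  shows "difference_set copy (\<phi> ` S) = \<phi> ` difference_set R S"
    and "difference_set R S \<subseteq> C"
proof -
  have m: "\<phi> a \<ominus>\<^bsub>copy\<^esub> \<phi> b = \<phi> (a \<ominus> b)" "a \<ominus> b \<in> C" if "a \<in> S" "b \<in> S" for a b
    using that assms minus_copy[of a b] by (auto simp: minus_eq copy_simps subset_iff)
  show "difference_set R S \<subseteq> C" by (auto simp: difference_set_def m)
  show "difference_set copy (\<phi> ` S) = \<phi> ` difference_set R S"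
  proof -
    have "\<phi> ` S \<times> \<phi> ` S = map_prod \<phi> \<phi> ` (S \<times> S)" by auto
    then show ?thesis
      unfolding difference_set_eq_image by (auto simp: image_image m(1) intro!: image_cong)
  qed
qed

lemma domain_copy:
  assumes "domain R" "\<one> \<in> C"
  shows "domain copy"
proof -
  interpret D: domain R by fact
  have "cring copy"
    using assms(2) copy.abelian_group_axioms
    by (intro cringI comm_monoidI) (auto simp: copy_simps l_distr r_distr D.m_ac)
  then show ?thesis
    using assms(2)
    by (intro domain.intro domain_axioms.intro) (auto simp: copy_simps phi_eq_iff D.integral_iff)
qed

lemma ring_char_copy:
  assumes "domain R" "\<one> \<in> C"
  shows "ring_char copy = ring_char R"
proof -
  have "[n] \<cdot> \<one> \<in> C \<and> [n] \<cdot>\<^bsub>copy\<^esub> \<one>\<^bsub>copy\<^esub> = \<phi> ([n] \<cdot> \<one>)" for n :: nat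
    using assms(2) by (induction n) (auto simp: copy_simps)
  then have "[n] \<cdot>\<^bsub>copy\<^esub> \<one>\<^bsub>copy\<^esub> = \<zero>\<^bsub>copy\<^esub> \<longleftrightarrow> [n] \<cdot> \<one> = \<zero>" for n :: nat
    by (metis phi_eq_iff zero_copy zero_mem)
  then show ?thesis unfolding ring_char_def by presburger
qed

text \<open>Since \<open>\<phi>\<close> is injective on \<open>C\<close>, taking preimages in
  \<open>S\<close> keeps cardinalities. It commutes with power sums, so equations and inequations
  between them pass back to \<open>R\<close>.\<close>

lemma family_from_copy:
  assumes S: "finite S" "S \<subseteq> C" and A: "equal_power_sums_family copy (\<phi> ` S) k m A"
    and "m \<ge> 1"
  defines "A' \<equiv> \<lambda>i. {x \<in> S. \<phi> x \<in> A i}"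
  shows "equal_power_sums_family R S k m A'"
    and "\<And>i. i \<in> {1..m} \<Longrightarrow> \<phi> ` A' i = A i"
    and "\<And>i j. i \<in> {1..m} \<Longrightarrow> power_sum copy j (A i) = \<phi> (power_sum R j (A' i))"
    and "\<And>i j. i \<in> {1..m} \<Longrightarrow> power_sum R j (A' i) \<in> C"
proof -
  show im: "\<phi> ` A' i = A i" if "i \<in> {1..m}" for i
    using A that unfolding equal_power_sums_family_def A'_def by blast
  have A'S: "A' i \<subseteq> S" "finite (A' i)" "A' i \<subseteq> C" for i
    using S by (auto simp: A'_def)
  show ps: "power_sum copy j (A i) = \<phi> (power_sum R j (A' i))" if "i \<in> {1..m}" for i j
    using power_sum_copy[OF A'S(2)[of i] A'S(3)[of i], of j] im[OF that] by simp
  show mem: "power_sum R j (A' i) \<in> C" if "i \<in> {1..m}" for i j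
    using power_sum_copy[OF A'S(2)[of i] A'S(3)[of i], of j] by simp
  have "A' i \<subseteq> S \<and> card (A' i) = nat \<lceil>log 2 (real m)\<rceil> * 2 ^ k" if "i \<in> {1..m}" for i
  proof -
    have "card (A' i) = card (A i)"
      using im[OF that] inj_on_subset[OF inj A'S(3)] by (metis card_image)
    moreover have "card (A i) = nat \<lceil>log 2 (real m)\<rceil> * 2 ^ k"
      using A that unfolding equal_power_sums_family_def by blast
    ultimately show ?thesis using A'S(1) by simp
  qed
  moreover have "power_sum R j (A' i) = power_sum R j (A' 1)" if "j \<in> {1..k}" "i \<in> {1..m}" for i j
  proof -
    have "1 \<in> {1..m}" using assms(4) by simp
    then show ?thesis
      using A that ps mem unfolding equal_power_sums_family_def by (metis phi_eq_iff)
  qed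
  ultimately show "equal_power_sums_family R S k m A'"
    unfolding equal_power_sums_family_def by blast
qed

end

text \<open>Both \<open>K\<close> and the two conclusions involve only the subring generated by
  finitely many elements. This subring is countable and has an isomorphic copy carried by natural
  numbers.\<close>

lemma admissible_constant_if_all_nat_rings:
  fixes R :: "('a, 'b) ring_scheme" (structure)
  assumes "rng R" and adm: "\<And>R :: nat ring. rng R \<Longrightarrow> admissible_constant k m c R" and "m \<ge> 1"
  shows "admissible_constant k m c R"
  unfolding admissible_constant_def
proof (intro allI impI)
  interpret rng R by fact
  let ?E = "1 / (2 ^ (k + 1) - 1) :: real"
  fix S K assume "S \<subseteq> carrier R \<and> finite S \<and> S \<noteq> {} \<and>
    real (card (difference_set R S)) = K * real (card S) \<and> K \<le> c * real (card S) powr ?E"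
  then have S: "finite S" "S \<noteq> {}" "S \<subseteq> carrier R"
    and K: "real (card (difference_set R S)) = K * real (card S)" "K \<le> c * real (card S) powr ?E"
    by auto
  \<comment> \<open>The unit joins the generators only if it lies in the carrier, as it is
    unconstrained in a \<open>rng\<close>. In a domain it does lie there, so that the copy is a
    domain of the same characteristic.\<close>
  have "finite (insert \<zero> (S \<union> ({\<one>} \<inter> carrier R)))" "insert \<zero> (S \<union> ({\<one>} \<inter> carrier R)) \<subseteq> carrier R"
    using S by auto
  then obtain C where C: "countable C" "insert \<zero> (S \<union> ({\<one>} \<inter> carrier R)) \<subseteq> C" "C \<subseteq> carrier R"
    "\<And>x y. \<lbrakk>x \<in> C; y \<in> C\<rbrakk> \<Longrightarrow> x \<oplus> y \<in> C"
    "\<And>x y. \<lbrakk>x \<in> C; y \<in> C\<rbrakk> \<Longrightarrow> x \<otimes> y \<in> C" "\<And>x. x \<in> C \<Longrightarrow> \<ominus> x \<in> C"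
    using exists_countable_closed_subset by blast
  define \<phi> where "\<phi> = to_nat_on C"
  interpret subrng_copy R C \<phi>
    using C by unfold_locales (auto simp: \<phi>_def)
  have SC: "S \<subseteq> C" using C(2) by auto
  have "card (\<phi> ` S) = card S"
    using inj_on_subset[OF inj SC] by (rule card_image)
  moreover have "card (difference_set copy (\<phi> ` S)) = card (difference_set R S)"
    unfolding difference_set_copy(1)[OF SC]
    using inj_on_subset[OF inj difference_set_copy(2)[OF SC]] by (rule card_image)
  moreover have "\<phi> ` S \<subseteq> carrier copy" using SC by (auto simp: carrier_copy)
  ultimately have "\<phi> ` S \<subseteq> carrier copy \<and> finite (\<phi> ` S) \<and> \<phi> ` S \<noteq> {} \<and>
      real (card (difference_set copy (\<phi> ` S))) = K * real (card (\<phi> ` S)) \<and>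
      K \<le> c * real (card (\<phi> ` S)) powr ?E"
    using S K by simp
  then have copy_result: "(\<exists>A. inj_on A {1..m} \<and> equal_power_sums_family copy (\<phi> ` S) k m A) \<and>
       (domain copy \<and> (ring_char copy = 0 \<or> ring_char copy > k + 1) \<longrightarrow>
         (\<exists>A. equal_power_sums_family copy (\<phi> ` S) k m A \<and>
           (\<forall>h\<in>{1..m}. \<forall>t\<in>{1..m}. h \<noteq> t \<longrightarrow>
             power_sum copy (k + 1) (A h) \<noteq> power_sum copy (k + 1) (A t))))"
    using adm[OF copy.rng_axioms] unfolding admissible_constant_def by blast
  show "(\<exists>A. inj_on A {1..m} \<and> equal_power_sums_family R S k m A) \<and>
       (domain R \<and> (ring_char R = 0 \<or> ring_char R > k + 1) \<longrightarrow>
         (\<exists>A. equal_power_sums_family R S k m A \<and>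
           (\<forall>h\<in>{1..m}. \<forall>t\<in>{1..m}. h \<noteq> t \<longrightarrow>
             power_sum R (k + 1) (A h) \<noteq> power_sum R (k + 1) (A t))))"
  proof (intro conjI impI)
    obtain A where A: "inj_on A {1..m}" "equal_power_sums_family copy (\<phi> ` S) k m A"
      using copy_result by blast
    note A' = family_from_copy[OF S(1) SC A(2) \<open>m \<ge> 1\<close>]
    have "inj_on (\<lambda>i. {x \<in> S. \<phi> x \<in> A i}) {1..m}"
    proof (rule inj_onI)
      fix i j assume ij: "i \<in> {1..m}" "j \<in> {1..m}" "{x \<in> S. \<phi> x \<in> A i} = {x \<in> S. \<phi> x \<in> A j}"
      have "\<phi> ` {x \<in> S. \<phi> x \<in> A i} = \<phi> ` {x \<in> S. \<phi> x \<in> A j}" by (simp only: ij(3))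
      then have "A i = A j" by (simp only: A'(2)[OF ij(1)] A'(2)[OF ij(2)])
      then show "i = j" by (rule inj_onD[OF A(1) _ ij(1,2)])
    qed
    then show "\<exists>A. inj_on A {1..m} \<and> equal_power_sums_family R S k m A"
      using A'(1) by blast
  next
    assume dom: "domain R \<and> (ring_char R = 0 \<or> ring_char R > k + 1)"
    then interpret domain R by blast
    have "\<one> \<in> C" using C(2) by auto
    then have "domain copy \<and> (ring_char copy = 0 \<or> ring_char copy > k + 1)"
      using dom domain_copy ring_char_copy by simp
    then obtain A where A: "equal_power_sums_family copy (\<phi> ` S) k m A"
      "\<forall>h\<in>{1..m}. \<forall>t\<in>{1..m}. h \<noteq> t \<longrightarrow>
        power_sum copy (k + 1) (A h) \<noteq> power_sum copy (k + 1) (A t)"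
      using copy_result by blast
    note A' = family_from_copy[OF S(1) SC A(1) \<open>m \<ge> 1\<close>]
    have "power_sum R (k + 1) {x \<in> S. \<phi> x \<in> A h} \<noteq> power_sum R (k + 1) {x \<in> S. \<phi> x \<in> A t}"
      if "h \<in> {1..m}" "t \<in> {1..m}" "h \<noteq> t" for h t
    proof
      assume "power_sum R (k + 1) {x \<in> S. \<phi> x \<in> A h} = power_sum R (k + 1) {x \<in> S. \<phi> x \<in> A t}"
      then have "power_sum copy (k + 1) (A h) = power_sum copy (k + 1) (A t)"
        by (simp only: A'(3)[OF that(1)] A'(3)[OF that(2)])
      then show False using A(2) that by blast
    qed
    then show "\<exists>A. equal_power_sums_family R S k m A \<and>
      (\<forall>h\<in>{1..m}. \<forall>t\<in>{1..m}. h \<noteq> t \<longrightarrow> power_sum R (k + 1) (A h) \<noteq> power_sum R (k + 1) (A t))"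
      by (intro exI[of _ "\<lambda>i. {x \<in> S. \<phi> x \<in> A i}"]) (use A'(1) in blast)
  qed
qed

text \<open>The explicit constant found above, at the type of rings on \<open>nat\<close>, shows
  that the choice is made among existing values.\<close>

lemma uniform_constant_spec:
  assumes "m \<ge> 2"
  shows "uniform_constant k m > 0"
    and "\<And>R :: nat ring. rng R \<Longrightarrow> admissible_constant k m (uniform_constant k m) R"
proof -
  have "uniform_constant k m > 0 \<and>
      (\<forall>R :: nat ring. rng R \<longrightarrow> admissible_constant k m (uniform_constant k m) R)"
    unfolding uniform_constant_def
    by (rule someI_ex[OF exists_admissible_constant[OF assms, where 'a = nat and 'b = unit and k = k]])
  then show "uniform_constant k m > 0"
    and "\<And>R :: nat ring. rng R \<Longrightarrow> admissible_constant k m (uniform_constant k m) R" by auto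
qed

theorem theorem1p1:
  fixes k m :: nat
  assumes "k \<ge> 1" and "m \<ge> 2"
  shows "uniform_constant k m > 0 \<and>
    (\<forall>(R :: ('a, 'b) ring_scheme) S K.
       rng R \<and> S \<subseteq> carrier R \<and> finite S \<and> S \<noteq> {} \<and>
       real (card (difference_set R S)) = K * real (card S) \<and>
       K \<le> uniform_constant k m * real (card S) powr (1 / (2 ^ (k + 1) - 1)) \<longrightarrow>
       (\<exists>A. inj_on A {1..m} \<and> equal_power_sums_family R S k m A) \<and>
       (domain R \<and> (ring_char R = 0 \<or> ring_char R > k + 1) \<longrightarrow>
         (\<exists>A. equal_power_sums_family R S k m A \<and>
           (\<forall>h\<in>{1..m}. \<forall>t\<in>{1..m}. h \<noteq> t \<longrightarrow>
             power_sum R (k + 1) (A h) \<noteq> power_sum R (k + 1) (A t)))))"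
proof (rule conjI[OF uniform_constant_spec(1)[OF assms(2)]], intro allI, rule impI)
  fix R :: "('a, 'b) ring_scheme" and S K
  assume h: "rng R \<and> S \<subseteq> carrier R \<and> finite S \<and> S \<noteq> {} \<and>
    real (card (difference_set R S)) = K * real (card S) \<and>
    K \<le> uniform_constant k m * real (card S) powr (1 / (2 ^ (k + 1) - 1))"
  have "admissible_constant k m (uniform_constant k m) R"
    by (rule admissible_constant_if_all_nat_rings[OF conjunct1[OF h] uniform_constant_spec(2)])
      (use assms(2) in simp_all)
  from this[unfolded admissible_constant_def, THEN spec, THEN spec, THEN mp, OF conjunct2[OF h]]
  show "(\<exists>A. inj_on A {1..m} \<and> equal_power_sums_family R S k m A) \<and>
    (domain R \<and> (ring_char R = 0 \<or> ring_char R > k + 1) \<longrightarrow>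
      (\<exists>A. equal_power_sums_family R S k m A \<and>
        (\<forall>h\<in>{1..m}. \<forall>t\<in>{1..m}. h \<noteq> t \<longrightarrow>
          power_sum R (k + 1) (A h) \<noteq> power_sum R (k + 1) (A t))))" .
qed

end
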